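(* For any signed graph $(G,\sigma)$, if $G$ is a planar graph then $AT(G,\sigma)\le 5$.
   Context: A signed graph $(G,\sigma)$ consists of a finite simple graph $G$ and a map $\sigma\colon E(G)\to\{+1,-1\}$. Fix an arbitrary linear ordering $<$ of $V(G)$. The graph polynomial is $P_{G,\sigma}(\mathbf{x})=\prod_{uv\in E(G),\,u<v}(x_u-\sigma(uv)x_v)\in\mathbb{Z}[x_v : v\in V(G)]$. The Alon–Tarsi number $AT(G,\sigma)$ is the minimum $k$ such that the expansion of $P_{G,\sigma}(\mathbf{x})$ contains a monomial $c\prod_{v\in V(G)}x_v^{t_v}$ with $c\neq 0$ and $t_v<k$ for all $v\in V(G)$ (this does not depend on the chosen ordering). *)

theory Defs
  imports "HOL-Analysis.Analysis" "HOL-Library.Poly_Mapping"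
begin

locale simple_graph =
  fixes V :: "'v set" and E :: "'v set set"
  assumes finite_V: "finite V"
    and edges: "e \<in> E \<Longrightarrow> e \<subseteq> V \<and> card e = 2"

locale signed_graph = simple_graph V E
  for V :: "'v set" and E :: "'v set set" +
  fixes \<sigma> :: "'v set \<Rightarrow> int"
  assumes signs: "e \<in> E \<Longrightarrow> \<sigma> e \<in> {1, -1}"

(* Planarity is topological.  The Euclidean plane is the type complex, as in HOL-Analysis.Jordan_Curve.
   The last conjunct says that distinct edges meet at most in the point of a common endvertex;
   the values of g outside E are irrelevant. *)

definition plane_drawing ::
    "'v set \<Rightarrow> 'v set set \<Rightarrow> ('v \<Rightarrow> complex) \<Rightarrow> ('v set \<Rightarrow> real \<Rightarrow> complex) \<Rightarrow> bool" where
  "plane_drawing V E p g \<longleftrightarrow>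
     inj_on p V \<and>
     (\<forall>e\<in>E. arc (g e) \<and>
            {pathstart (g e), pathfinish (g e)} = p ` e \<and>
            path_image (g e) \<inter> p ` V = p ` e) \<and>
     (\<forall>e\<in>E. \<forall>f\<in>E. e \<noteq> f \<longrightarrow> path_image (g e) \<inter> path_image (g f) \<subseteq> p ` (e \<inter> f))"

definition planar :: "'v set \<Rightarrow> 'v set set \<Rightarrow> bool" where
  "planar V E \<longleftrightarrow> (\<exists>p g. plane_drawing V E p g)"

(* Polynomials in the variables x_v with integer coefficients: a monomial is its exponent
   function 'v \<Rightarrow>\<^sub>0 nat, and a polynomial assigns integer coefficients to finitely many monomials. *)

type_synonym 'v int_mpoly = "('v \<Rightarrow>\<^sub>0 nat) \<Rightarrow>\<^sub>0 int"

definition Var :: "'v \<Rightarrow> 'v int_mpoly" where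
  "Var v = Poly_Mapping.single (Poly_Mapping.single v 1) 1"

(* r is the (reflexive) ordering of the vertices, so u < v reads (u, v) \<in> r and u \<noteq> v. *)

definition graph_polynomial ::
    "'v rel \<Rightarrow> 'v set set \<Rightarrow> ('v set \<Rightarrow> int) \<Rightarrow> 'v int_mpoly" where
  "graph_polynomial r E \<sigma> =
     (\<Prod>(u, v) | {u, v} \<in> E \<and> (u, v) \<in> r \<and> u \<noteq> v. Var u - of_int (\<sigma> {u, v}) * Var v)"

definition Alon_Tarsi_number ::
    "'v rel \<Rightarrow> 'v set \<Rightarrow> 'v set set \<Rightarrow> ('v set \<Rightarrow> int) \<Rightarrow> nat" where
  "Alon_Tarsi_number r V E \<sigma> =
     (LEAST k. \<exists>t. Poly_Mapping.lookup (graph_polynomial r E \<sigma>) t \<noteq> 0 \<and>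
                   (\<forall>v\<in>V. Poly_Mapping.lookup t v < k))"

end

theory Submission
  imports Defs
begin

text \<open>
  This is Thomassen's induction, in the form Zhu gave it for Alon--Tarsi numbers, but run without
  faces or triangulations. A connected set \<open>Z\<close> of vertices already deleted plays the role of the
  outer face: the outer vertices of the remaining graph on \<open>W\<close> are the neighbours \<open>F\<close> of \<open>Z\<close> in \<open>W\<close>.
  One shows that the polynomial of the graph on \<open>W\<close>, without a root edge \<open>R\<close> inside \<open>F\<close>, has a
  nonvanishing monomial with exponent 0 on \<open>R\<close>, at most 2 on \<open>F\<close> and at most 4 elsewhere.

  If some vertex of \<open>F - R\<close> has at most two neighbours in \<open>F\<close>, at most one of them outside \<open>R\<close>, it is
  moved to \<open>Z\<close>. Otherwise either both ends of a longest path in \<open>F - R\<close> are joined to both roots,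
  which together with \<open>Z\<close> gives a \<open>K\<^sub>5\<close>, or \<open>F - R\<close> contains a cycle. As every vertex of the cycle
  is adjacent to \<open>Z\<close>, the part of the graph containing \<open>R\<close> attaches to the cycle in at most two vertices,
  adjacent if there are two (otherwise there would be a \<open>K\<^sub>5\<close> or \<open>K\<^sub>3\<^sub>,\<^sub>3\<close>), and the graph splits there.

  Both exclusions come from one consequence of the Jordan curve theorem: two disjoint chords of a
  closed curve with interleaving ends lie on different sides of it.
\<close>

text \<open>The bounds 0, 2 and 4 are Thomassen's list sizes 1, 3 and 5 lowered by one; precoloured
  roots turn into exponent 0 with the root edge left out. Exponent 0 is also what makes gluing
  possible: the second piece contributes nothing at the separator, so the combined monomial arises
  in one way only. The obstacle compared with list colouring is cancellation, since a monomial of a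
  product may receive several contributions. Each extension step is arranged so that all
  contributions but one vanish, mostly because the other end of a new edge has exponent 0. Where
  this fails, in \<open>good_remove\<close>, one either passes to a better monomial or uses that
  none exists to exclude the competing terms. Signs enter only through both coefficients of an edge
  factor being nonzero. Contracting \<open>Z\<close> gives one vertex adjacent to all of
  \<open>F\<close>; this is the form in which \<open>F\<close> being an outer boundary is
  used.\<close>

section \<open>Chords of a Jordan curve\<close>

text \<open>The chord \<open>c\<close> divides the inside of the closed curve into two open pieces,
  and the closure of each piece misses the interior of one of the arcs \<open>c1\<close>,
  \<open>c2\<close>. A connected set avoiding \<open>c\<close> stays in one piece, so it cannot
  approach both arcs.\<close>

lemma theta_inside_crossing:
  fixes c1 c2 c :: "real \<Rightarrow> complex"
  assumes c1: "arc c1" "pathstart c1 = a" "pathfinish c1 = b"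
    and c2: "arc c2" "pathstart c2 = a" "pathfinish c2 = b"
    and c: "arc c" "pathstart c = a" "pathfinish c = b"
    and c12: "path_image c1 \<inter> path_image c2 = {a, b}"
    and c1c: "path_image c1 \<inter> path_image c = {a, b}"
    and c2c: "path_image c2 \<inter> path_image c = {a, b}"
    and ne: "path_image c \<inter> inside (path_image c1 \<union> path_image c2) \<noteq> {}"
    and B: "connected B" "B \<subseteq> inside (path_image c1 \<union> path_image c2) - path_image c"
    and x: "x \<in> closure B" "x \<in> path_image c1 - {a, b}"
    and y: "y \<in> closure B" "y \<in> path_image c2 - {a, b}"
  shows False
proof -
  let ?C = "path_image c1 \<union> path_image c2"
  let ?I1 = "inside (path_image c1 \<union> path_image c)"
  let ?I2 = "inside (path_image c2 \<union> path_image c)"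
  have ab: "a \<noteq> b"
    using arc_distinct_ends[OF c1(1)] c1 by auto
  have disj: "?I1 \<inter> ?I2 = {}" and un: "?I1 \<union> ?I2 \<union> (path_image c - {a, b}) = inside ?C"
    using split_inside_simple_closed_curve[OF arc_imp_simple_path[OF c1(1)] c1(2,3)
        arc_imp_simple_path[OF c2(1)] c2(2,3) arc_imp_simple_path[OF c(1)] c(2,3) ab c12 c1c c2c ne]
    by blast+
  have cl: "closed (path_image c1)" "closed (path_image c2)" "closed (path_image c)"
    using c1 c2 c by (auto simp: closed_arc_image)
  then have op: "open ?I1" "open ?I2"
    by (auto intro: open_inside)
  have "B \<subseteq> ?I1 \<union> ?I2"
    using B(2) un by blast
  then have "B \<subseteq> ?I1 \<or> B \<subseteq> ?I2"
    using connectedD[OF B(1) op] disj by blast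
  moreover have "closure ?I1 \<subseteq> (path_image c1 \<union> path_image c) \<union> ?I1"
       "closure ?I2 \<subseteq> (path_image c2 \<union> path_image c) \<union> ?I2"
    using cl closure_inside_subset[of "path_image c1 \<union> path_image c"]
      closure_inside_subset[of "path_image c2 \<union> path_image c"] by (simp_all add: closed_Un)
  moreover have "x \<notin> inside ?C" "y \<notin> inside ?C"
    using x y inside_no_overlap[of ?C] by blast+
  moreover have "B \<subseteq> ?I1 \<Longrightarrow> y \<in> closure ?I1" "B \<subseteq> ?I2 \<Longrightarrow> x \<in> closure ?I2"
    using x y closure_mono by blast+
  ultimately show False
    using x(2) y(2) c12 c1c c2c un by blast
qed

text \<open>This turns chords outside a closed curve into chords inside one. Under inversion about
  \<open>w\<close> the outside together with infinity becomes a bounded open set \<open>U\<close>,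
  and a component of the complement of the image curve that meets \<open>U\<close> stays in
  \<open>U\<close>.\<close>

lemma inversion_outside_subset_inside:
  fixes C :: "complex set"
  assumes "compact C" and w: "w \<in> inside C"
  shows "(\<lambda>z. inverse (z - w)) ` outside C \<subseteq> inside ((\<lambda>z. inverse (z - w)) ` C)"
proof -
  define \<phi> where "\<phi> = (\<lambda>z. inverse (z - w))"
  \<comment> \<open>The added 0 is the image of infinity; with it \<open>U\<close> and
    \<open>W\<close> cover the complement of the image curve.\<close>
  define U where "U = insert 0 (\<phi> ` outside C)"
  define W where "W = \<phi> ` (inside C - {w})"
  have cl: "closed C"
    using assms(1) compact_imp_closed by blast
  have wC: "w \<notin> C" "w \<notin> outside C"
    using w inside_no_overlap[of C] inside_Int_outside[of C] by blast+
  \<comment> \<open>Since \<open>inverse 0 = 0\<close>, the map is a bijection of the whole plane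
    with \<open>w\<close> going to 0; only continuity fails, at \<open>w\<close>.\<close>
  have phi_inv: "\<phi> (w + inverse u) = u" for u
    by (simp add: \<phi>_def)
  have inv_phi: "w + inverse (\<phi> z) = z" for z
    by (simp add: \<phi>_def)
  have inj: "\<phi> z = \<phi> z' \<Longrightarrow> z = z'" for z z'
    by (metis inv_phi)
  have img: "\<phi> ` S = {u. u \<noteq> 0 \<and> w + inverse u \<in> S}" if "w \<notin> S" for S
  proof -
    have "u \<in> \<phi> ` S" if "w + inverse u \<in> S" for u
      using that phi_inv by (metis imageI)
    moreover have "\<phi> z \<noteq> 0 \<and> w + inverse (\<phi> z) \<in> S" if "z \<in> S" for z
      using that \<open>w \<notin> S\<close> inv_phi by (auto simp: \<phi>_def)
    ultimately show ?thesis by auto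
  qed
  have op_img: "open (\<phi> ` S)" if "open S" "w \<notin> S" for S
  proof -
    have "open (- {0} \<inter> (\<lambda>u. w + inverse u) -` S)"
      by (rule continuous_open_preimage) (auto intro!: continuous_intros that)
    moreover have "- {0} \<inter> (\<lambda>u. w + inverse u) -` S = \<phi> ` S"
      using img[OF that(2)] by auto
    ultimately show ?thesis by simp
  qed
  have op_W: "open W"
    unfolding W_def by (rule op_img) (auto intro!: open_delete open_inside cl)
  obtain r where r: "r > 0" "\<And>z. z \<in> C \<union> inside C \<Longrightarrow> norm z \<le> r"
    using bounded_inside[OF compact_imp_bounded[OF assms(1)]] compact_imp_bounded[OF assms(1)]
    by (metis bounded_Un bounded_pos)
  \<comment> \<open>For nonzero \<open>u\<close> of norm below this value, the preimage
    \<open>w + inverse u\<close> has norm above \<open>r\<close>, hence lies outside the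
    curve.\<close>
  define \<epsilon> where "\<epsilon> = inverse (r + norm w)"
  have eps: "\<epsilon> > 0"
    using r(1) by (auto simp: \<epsilon>_def add_pos_nonneg)
  have ball: "ball 0 \<epsilon> \<subseteq> U"
  proof
    fix u :: complex assume u: "u \<in> ball 0 \<epsilon>"
    show "u \<in> U"
    proof (cases "u = 0")
      case False
      then have "inverse (norm u) > r + norm w"
        using u eps r(1) unfolding \<epsilon>_def
        by (metis add_pos_nonneg dist_0_norm inverse_inverse_eq less_imp_inverse_less mem_ball
            norm_ge_zero zero_less_norm_iff)
      moreover have "norm (inverse u) \<le> norm (w + inverse u) + norm w"
        by (metis add_diff_cancel_left' norm_triangle_ineq4)
      ultimately have "norm (w + inverse u) > r"
        by (simp add: norm_inverse)
      then have "w + inverse u \<notin> C \<union> inside C"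
        using r(2) by (metis linorder_not_less)
      then have "w + inverse u \<in> outside C"
        using inside_Un_outside[of C] by blast
      then show ?thesis
        using phi_inv unfolding U_def by (metis imageI insertI2)
    qed (simp add: U_def)
  qed
  have "U = \<phi> ` outside C \<union> ball 0 \<epsilon>"
    using ball eps by (auto simp: U_def)
  then have op_U: "open U"
    using op_img[of "outside C"] wC cl open_outside by (metis open_Un open_ball)
  \<comment> \<open>A disc about \<open>w\<close> without outside points is what bounds
    \<open>U\<close>.\<close>
  obtain \<delta> where \<delta>: "\<delta> > 0" "ball w \<delta> \<subseteq> inside C"
    using open_inside[OF cl] w open_contains_ball by metis
  have "norm u \<le> inverse \<delta>" if u: "u \<in> U" for u
  proof (cases "u = 0")
    case True then show ?thesis using \<delta> by simp
  next
    case False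
    then obtain z where z: "z \<in> outside C" "u = \<phi> z"
      using u U_def by blast
    then have "z \<notin> ball w \<delta>"
      using \<delta> inside_Int_outside[of C] by blast
    then have "norm (z - w) \<ge> \<delta>"
      by (simp add: dist_norm norm_minus_commute)
    then show ?thesis
      using z \<delta> by (simp add: \<phi>_def norm_inverse le_imp_inverse_le)
  qed
  then have bU: "bounded U"
    by (meson boundedI)
  have UW: "U \<inter> W = {}"
  proof -
    have "\<phi> z \<noteq> 0" if "z \<in> inside C - {w}" for z
      using that by (simp add: \<phi>_def)
    then have "0 \<notin> W"
      unfolding W_def by force
    moreover have "\<phi> ` outside C \<inter> W = {}"
      unfolding W_def using inside_Int_outside[of C] inj by blast
    ultimately show ?thesis
      by (simp add: U_def)
  qed
  have cov: "- \<phi> ` C \<subseteq> U \<union> W"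
  proof
    fix u assume u: "u \<in> - \<phi> ` C"
    show "u \<in> U \<union> W"
    proof (cases "u = 0")
      case False
      have "w + inverse u \<notin> C"
        using u phi_inv by (metis ComplD imageI)
      then have "w + inverse u \<in> inside C \<or> w + inverse u \<in> outside C"
        using inside_Un_outside[of C] by blast
      moreover have "w + inverse u \<noteq> w"
        using False by simp
      ultimately have "w + inverse u \<in> inside C - {w} \<or> w + inverse u \<in> outside C"
        by blast
      then show ?thesis
        unfolding U_def W_def using phi_inv by (metis UnCI imageI insertI2)
    qed (simp add: U_def)
  qed
  show ?thesis
  proof (fold \<phi>_def, clarify)
    fix z assume z: "z \<in> outside C"
    let ?K = "connected_component_set (- \<phi> ` C) (\<phi> z)"
    have zC: "\<phi> z \<notin> \<phi> ` C"
      using z outside_no_overlap[of C] inj by blast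
    have "connected ?K" "?K \<subseteq> U \<union> W" "\<phi> z \<in> ?K"
      using cov connected_component_subset[of "- \<phi> ` C"] zC by auto
    moreover have "\<phi> z \<in> U"
      using z by (simp add: U_def)
    ultimately have "?K \<subseteq> U"
      using connectedD[OF _ op_U op_W, of ?K] UW by blast
    then show "\<phi> z \<in> inside (\<phi> ` C)"
      using zC bU bounded_subset by (auto simp: inside_def)
  qed
qed

text \<open>The inequality of truth values allows sides to be compared later by propositional
  reasoning. That both sets lie inside is excluded by \<open>theta_inside_crossing\<close>; that
  both lie outside is reduced to this by inversion about a point of the inside.\<close>

lemma theta_crossing:
  fixes c1 c2 c :: "real \<Rightarrow> complex"
  assumes c1: "arc c1" "pathstart c1 = a" "pathfinish c1 = b"
    and c2: "arc c2" "pathstart c2 = a" "pathfinish c2 = b"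
    and c: "arc c" "pathstart c = a" "pathfinish c = b"
    and c12: "path_image c1 \<inter> path_image c2 = {a, b}"
    and c1c: "path_image c1 \<inter> path_image c = {a, b}"
    and c2c: "path_image c2 \<inter> path_image c = {a, b}"
    and B: "connected B" "B \<inter> (path_image c1 \<union> path_image c2 \<union> path_image c) = {}"
    and x: "x \<in> closure B" "x \<in> path_image c1 - {a, b}"
    and y: "y \<in> closure B" "y \<in> path_image c2 - {a, b}"
  shows "(path_image c - {a, b} \<subseteq> inside (path_image c1 \<union> path_image c2)) \<noteq>
         (B \<subseteq> inside (path_image c1 \<union> path_image c2))"
proof -
  let ?C = "path_image c1 \<union> path_image c2"
  let ?c = "path_image c - {a, b}"
  have "simple_path (c1 +++ reversepath c2)" "pathfinish (c1 +++ reversepath c2) = pathstart (c1 +++ reversepath c2)"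
    using c1 c2 c12 by (auto intro!: simple_path_join_loop simp: arc_reversepath)
  moreover have "path_image (c1 +++ reversepath c2) = ?C"
    using c1 c2 by (simp add: path_image_join)
  ultimately have ine: "inside ?C \<noteq> {}"
    using Jordan_inside_outside by metis
  have comp: "compact ?C"
    using c1 c2 by (simp add: compact_Un compact_path_image arc_imp_path)
  have cl: "closed ?C"
    using comp compact_imp_closed by blast
  have sides: "S \<subseteq> inside ?C \<or> S \<subseteq> outside ?C" if "connected S" "S \<inter> ?C = {}" for S
    using connectedD[OF that(1) open_inside[OF cl] open_outside[OF cl]] that(2)
      inside_Un_outside[of ?C] inside_Int_outside[of ?C] by blast
  have "connected ?c"
    using connected_simple_path_endless[OF arc_imp_simple_path[OF c(1)]] c by simp
  moreover have "?c \<inter> ?C = {}"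
    using c1c c2c by blast
  ultimately have s1: "?c \<subseteq> inside ?C \<or> ?c \<subseteq> outside ?C"
    by (rule sides)
  have s2: "B \<subseteq> inside ?C \<or> B \<subseteq> outside ?C"
    by (rule sides) (use B in blast)+
  have cne: "?c \<noteq> {}"
    using nonempty_simple_path_endless[OF arc_imp_simple_path[OF c(1)]] c by simp
  have Bne: "B \<noteq> {}"
    using x by auto
  have io: "inside ?C \<inter> outside ?C = {}"
    by simp
  have False if "?c \<subseteq> inside ?C" "B \<subseteq> inside ?C"
    using theta_inside_crossing[OF c1 c2 c c12 c1c c2c _ B(1) _ x y] that B(2) cne by blast
  moreover have False if co: "?c \<subseteq> outside ?C" and Bo: "B \<subseteq> outside ?C"
  proof -
    obtain w where w: "w \<in> inside ?C"
      using ine by blast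
    define \<phi> where "\<phi> = (\<lambda>z. inverse (z - w))"
    have inj: "inj \<phi>"
      by (auto simp: inj_def \<phi>_def)
    have cont: "continuous_on (- {w}) \<phi>"
      unfolding \<phi>_def by (auto intro!: continuous_intros)
    have wn: "w \<notin> path_image c1" "w \<notin> path_image c2" "w \<notin> path_image c"
    proof -
      show n12: "w \<notin> path_image c1" "w \<notin> path_image c2"
        using w inside_no_overlap[of ?C] by blast+
      show "w \<notin> path_image c"
        using w co io n12 c12 by blast
    qed
    have arc: "arc (\<phi> \<circ> h)" if "arc h" "w \<notin> path_image h" for h
      using that inj cont unfolding arc_def
      by (auto intro!: path_continuous_image continuous_on_subset[OF cont] comp_inj_on inj_on_subset[OF inj])
    \<comment> \<open>The inversion has to be continuous on the closure of \<open>B\<close>, so that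
      limit points of \<open>B\<close> go to limit points of the image. The inside is open and
      misses \<open>B\<close>, so this closure stays away from \<open>w\<close>.\<close>
    have cb: "closure B \<inter> inside ?C = {}"
      using Bo io open_Int_closure_eq_empty[OF open_inside[OF cl], of B] by blast
    have clB: "\<phi> z \<in> closure (\<phi> ` B)" if "z \<in> closure B" for z
    proof -
      have "continuous_on (closure B) \<phi>"
        using cb w by (intro continuous_on_subset[OF cont]) blast
      then have "\<phi> ` closure B \<subseteq> closure (\<phi> ` B)"
        by (rule image_closure_subset) (auto intro: closure_subset[THEN subsetD])
      then show ?thesis using that by blast
    qed
    have im: "path_image (\<phi> \<circ> h) = \<phi> ` path_image h" for h
      by (simp add: path_image_compose)
    have sub: "\<phi> ` outside ?C \<subseteq> inside (\<phi> ` ?C)"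
      unfolding \<phi>_def by (rule inversion_outside_subset_inside[OF comp w])
    show False
    proof (rule theta_inside_crossing[of "\<phi> \<circ> c1" "\<phi> a" "\<phi> b" "\<phi> \<circ> c2" "\<phi> \<circ> c" "\<phi> ` B" "\<phi> x" "\<phi> y"])
      show "path_image (\<phi> \<circ> c) \<inter> inside (path_image (\<phi> \<circ> c1) \<union> path_image (\<phi> \<circ> c2)) \<noteq> {}"
        unfolding im using sub co cne by (auto simp: image_Un)
      have "B \<subseteq> - {w}"
        using Bo io w by blast
      then show "connected (\<phi> ` B)"
        using B(1) cont by (meson connected_continuous_image continuous_on_subset)
      show "\<phi> ` B \<subseteq> inside (path_image (\<phi> \<circ> c1) \<union> path_image (\<phi> \<circ> c2)) - path_image (\<phi> \<circ> c)"
        unfolding im using sub Bo B(2) by (auto simp: image_Un dest: injD[OF inj])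
    qed (use c1 c2 c c12 c1c c2c x y wn arc clB in
          \<open>auto simp: pathstart_compose pathfinish_compose im image_Int[OF inj, symmetric]
             inj_image_mem_iff[OF inj] inj_eq[OF inj]\<close>)
  qed
  ultimately show ?thesis
    using s1 s2 io cne Bne by blast
qed

section \<open>Paths in plane graphs\<close>

text \<open>Needed to present the ends of a path as limit points of its open arc, which then serves
  as the set \<open>B\<close> of \<open>theta_crossing\<close>.\<close>

lemma closure_arc_endless:
  fixes c :: "real \<Rightarrow> 'a::t2_space"
  assumes "arc c"
  shows "path_image c \<subseteq> closure (path_image c - {pathstart c, pathfinish c})"
proof -
  have "path_image c - {pathstart c, pathfinish c} = c ` {0<..<1}"
    using simple_path_endless[OF arc_imp_simple_path[OF assms]] .
  moreover have "c ` closure {0<..<1} \<subseteq> closure (c ` {0<..<1})"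
    by (rule image_closure_subset)
       (use assms in \<open>auto simp: arc_def path_def intro: closure_subset[THEN subsetD]\<close>)
  ultimately show ?thesis
    by (simp add: path_image_def)
qed

section \<open>Paths as vertex lists and connected vertex sets\<close>

fun pedges :: "'v list \<Rightarrow> 'v set set" where
  "pedges (x # y # zs) = insert {x, y} (pedges (y # zs))"
| "pedges _ = {}"

definition gpath :: "'v set set \<Rightarrow> 'v list \<Rightarrow> bool" where
  "gpath E xs \<longleftrightarrow> distinct xs \<and> pedges xs \<subseteq> E"

definition gpath_from_to :: "'v set set \<Rightarrow> 'v \<Rightarrow> 'v list \<Rightarrow> 'v \<Rightarrow> bool" where
  "gpath_from_to E a xs b \<longleftrightarrow> gpath E xs \<and> xs \<noteq> [] \<and> hd xs = a \<and> last xs = b"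

lemma pedges_append: "pedges (xs @ x # ys) = pedges (xs @ [x]) \<union> pedges (x # ys)"
  by (induction xs rule: pedges.induct) auto

lemma pedges_append2:
  assumes "xs \<noteq> []" "ys \<noteq> []"
  shows "pedges (xs @ ys) = insert {last xs, hd ys} (pedges xs \<union> pedges ys)"
  using assms by (induction xs rule: pedges.induct) (auto simp: neq_Nil_conv)

lemma pedges_Cons: "xs \<noteq> [] \<Longrightarrow> pedges (x # xs) = insert {x, hd xs} (pedges xs)"
  by (cases xs) auto

lemma pedges_rev [simp]: "pedges (rev xs) = pedges xs"
proof (induction xs rule: pedges.induct)
  case (1 x y zs)
  then show ?case
    using pedges_append[of "rev zs" y "[x]"] by (simp add: insert_commute)
qed auto

lemma Union_pedges_subset: "\<Union> (pedges xs) \<subseteq> set xs"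
  by (induction xs rule: pedges.induct) auto

lemma Union_pedges: "length xs \<ge> 2 \<Longrightarrow> \<Union> (pedges xs) = set xs"
proof (induction xs rule: pedges.induct)
  case (1 x y zs)
  then show ?case by (cases zs) auto
qed auto

lemma pedges_subset_set: "e \<in> pedges xs \<Longrightarrow> e \<subseteq> set xs"
  by (rule order_trans[OF Union_upper Union_pedges_subset])

lemma ends_notin_pedges:
  assumes "distinct xs" "length xs \<ge> 3"
  shows "{hd xs, last xs} \<notin> pedges xs"
proof -
  obtain a b c ys where "xs = a # b # c # ys"
    using assms(2) by (auto simp: numeral_3_eq_3 Suc_le_length_iff)
  then show ?thesis
    using assms(1) pedges_subset_set[of "{a, last xs}" "b # c # ys"] by (auto simp: doubleton_eq_iff)
qed

lemma gpath_rev [simp]: "gpath E (rev xs) = gpath E xs"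
  by (simp add: gpath_def)

lemma gpath_from_to_rev: "gpath_from_to E a xs b \<Longrightarrow> gpath_from_to E b (rev xs) a"
  by (auto simp: gpath_from_to_def hd_rev last_rev)

lemma gpath_from_to_in_set: "gpath_from_to E a xs b \<Longrightarrow> a \<in> set xs \<and> b \<in> set xs"
  by (auto simp: gpath_from_to_def)

lemma gpath_from_to_length: "gpath_from_to E a xs b \<Longrightarrow> a \<noteq> b \<Longrightarrow> length xs \<ge> 2"
  by (cases xs; cases "tl xs") (auto simp: gpath_from_to_def)

lemma gpath_from_to_length3:
  "gpath_from_to E a xs b \<Longrightarrow> x \<in> set xs - {a, b} \<Longrightarrow> length xs \<ge> 3"
  by (cases xs; cases "tl xs"; cases "tl (tl xs)") (auto simp: gpath_from_to_def)

lemma gpath_append_iff: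
  "gpath E (xs @ x # ys) \<longleftrightarrow> gpath E (xs @ [x]) \<and> gpath E (x # ys) \<and> set xs \<inter> set ys = {}"
  using pedges_append[of xs x ys] by (auto simp: gpath_def)

lemma gpath_from_to_append:
  "gpath_from_to E a (xs @ x # ys) b \<longleftrightarrow>
     gpath_from_to E a (xs @ [x]) x \<and> gpath_from_to E x (x # ys) b \<and> set xs \<inter> set ys = {}"
proof -
  have "hd (xs @ x # ys) = hd (xs @ [x])"
    by (cases xs) auto
  then show ?thesis
    using gpath_append_iff[of E xs x ys] by (auto simp: gpath_from_to_def)
qed

text \<open>The empty set counts as connected, so the induction can begin with nothing
  deleted.\<close>

definition gconnected :: "'v set set \<Rightarrow> 'v set \<Rightarrow> bool" where
  "gconnected E S \<longleftrightarrow> (\<forall>x\<in>S. \<forall>y\<in>S. \<exists>xs. gpath_from_to E x xs y \<and> set xs \<subseteq> S)"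

text \<open>The concatenation need not be simple, so it is cut at the first vertex of the first path that lies on the second.\<close>

lemma gpath_trans:
  assumes "gpath_from_to E x xs y" "gpath_from_to E y ys z"
  shows "\<exists>zs. gpath_from_to E x zs z \<and> set zs \<subseteq> set xs \<union> set ys"
proof -
  have "\<exists>u\<in>set xs. u \<in> set ys"
    using gpath_from_to_in_set assms by metis
  then obtain us u vs where xs: "xs = us @ u # vs" "u \<in> set ys" "\<forall>w\<in>set us. w \<notin> set ys"
    using split_list_first_prop[of xs "\<lambda>u. u \<in> set ys"] by blast
  obtain ps qs where ys: "ys = ps @ u # qs"
    using xs(2) split_list by metis
  have "gpath_from_to E x (us @ u # qs) z"
    using assms xs ys gpath_from_to_append[of E x us u vs y] gpath_from_to_append[of E y ps u qs z]
      gpath_from_to_append[of E x us u qs z] by auto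
  then show ?thesis
    using xs ys by (intro exI[of _ "us @ u # qs"]) auto
qed

lemma gconnected_singleton: "gconnected E {x}"
  unfolding gconnected_def gpath_from_to_def gpath_def
  by (auto intro!: exI[of _ "[x]"])

lemma gpath_from_to_edge: "{x, y} \<in> E \<Longrightarrow> x \<noteq> y \<Longrightarrow> gpath_from_to E x [x, y] y"
  by (simp add: gpath_from_to_def gpath_def)

lemma gconnected_Un:
  assumes "gconnected E S" "gconnected E T" "x \<in> S" "y \<in> T" "{x, y} \<in> E"
  shows "gconnected E (S \<union> T)"
proof -
  have xy: "\<exists>xs. gpath_from_to E u xs w \<and> set xs \<subseteq> S \<union> T" if "u \<in> S" "w \<in> T" for u w
  proof -
    obtain xs where xs: "gpath_from_to E u xs x" "set xs \<subseteq> S"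
      using assms \<open>u \<in> S\<close> unfolding gconnected_def by blast
    obtain ys where ys: "gpath_from_to E y ys w" "set ys \<subseteq> T"
      using assms \<open>w \<in> T\<close> unfolding gconnected_def by blast
    obtain zs where zs: "gpath_from_to E x zs y" "set zs \<subseteq> {x, y}"
    \<comment> \<open>Here \<open>E\<close> is an arbitrary family of sets, so \<open>{x, y}\<close>
      may be a singleton.\<close>
    proof (cases "x = y")
      case True
      show ?thesis
        by (rule that[of "[x]"]) (auto simp: True gpath_from_to_def gpath_def)
    next
      case False
      show ?thesis
        by (rule that[OF gpath_from_to_edge[OF assms(5) False]]) auto
    qed
    obtain us where us: "gpath_from_to E u us y" "set us \<subseteq> set xs \<union> set zs"
      using gpath_trans[OF xs(1) zs(1)] by blast
    obtain ws where "gpath_from_to E u ws w" "set ws \<subseteq> set us \<union> set ys"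
      using gpath_trans[OF us(1) ys(1)] by blast
    then show ?thesis
      using us zs xs ys assms(3,4) by (intro exI[of _ ws]) blast
  qed
  have yx: "\<exists>xs. gpath_from_to E w xs u \<and> set xs \<subseteq> S \<union> T" if "u \<in> S" "w \<in> T" for u w
    using xy[OF that] gpath_from_to_rev set_rev by metis
  show ?thesis
    unfolding gconnected_def
  proof (intro ballI)
    fix u w assume "u \<in> S \<union> T" "w \<in> S \<union> T"
    then consider "u \<in> S" "w \<in> S" | "u \<in> T" "w \<in> T" | "u \<in> S" "w \<in> T" | "u \<in> T" "w \<in> S"
      by blast
    then show "\<exists>xs. gpath_from_to E u xs w \<and> set xs \<subseteq> S \<union> T"
    proof cases
      case 1 then show ?thesis using assms(1) unfolding gconnected_def by blast
    next
      case 2 then show ?thesis using assms(2) unfolding gconnected_def by blast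
    qed (use xy yx in blast)+
  qed
qed

lemma gconnected_insert:
  assumes "gconnected E S" "x \<in> S" "{x, y} \<in> E"
  shows "gconnected E (insert y S)"
  using gconnected_Un[OF assms(1) gconnected_singleton assms(2) _ assms(3)] by simp

text \<open>Stopping at the first vertex of \<open>P\<close> yields paths that meet a given cycle
  only at their ends, as chords must.\<close>

lemma gpath_first_hit:
  assumes "gconnected E S" "s \<in> S" "P \<inter> S \<noteq> {}"
  obtains ys x where "gpath_from_to E s ys x" "set ys \<subseteq> S" "x \<in> P" "set ys \<inter> P = {x}"
proof -
  obtain t where "t \<in> P" "t \<in> S"
    using assms(3) by blast
  then obtain xs where xs: "gpath_from_to E s xs t" "set xs \<subseteq> S"
    using assms unfolding gconnected_def by blast
  have "\<exists>u\<in>set xs. u \<in> P"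
    using xs gpath_from_to_in_set \<open>t \<in> P\<close> by metis
  then obtain us u vs where u: "xs = us @ u # vs" "u \<in> P" "\<forall>w\<in>set us. w \<notin> P"
    using split_list_first_prop[of xs "\<lambda>u. u \<in> P"] by blast
  have "gpath_from_to E s (us @ [u]) u"
    using xs(1) u(1) gpath_from_to_append[of E s us u vs t] by simp
  then show ?thesis
    using u xs by (intro that[of "us @ [u]" u]) auto
qed

lemma gpath_from_to_Cons:
  assumes "gpath_from_to E x xs b" "a \<notin> set xs" "{a, x} \<in> E"
  shows "gpath_from_to E a (a # xs) b"
  using assms by (auto simp: gpath_from_to_def gpath_def pedges_Cons)

lemma gpath_from_to_snoc:
  assumes "gpath_from_to E a xs x" "b \<notin> set xs" "{x, b} \<in> E"
  shows "gpath_from_to E a (xs @ [b]) b"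
  using assms by (auto simp: gpath_from_to_def gpath_def pedges_append2)

text \<open>Builds a chord through a connected set. The inner path is returned as well because its
  end \<open>x\<close> is an inner vertex at which the side of the chord can be read off.\<close>

lemma gpath_via:
  assumes "gconnected E S" "x \<in> S" "y \<in> S" "{a, x} \<in> E" "{b, y} \<in> E" "a \<notin> S" "b \<notin> S" "a \<noteq> b"
  obtains xs where "gpath_from_to E a (a # xs @ [b]) b" "set xs \<subseteq> S" "gpath_from_to E x xs y"
proof -
  obtain xs where xs: "gpath_from_to E x xs y" "set xs \<subseteq> S"
    using assms unfolding gconnected_def by blast
  have "gpath_from_to E x (xs @ [b]) b"
    using xs assms by (intro gpath_from_to_snoc[OF xs(1)]) (auto simp: insert_commute)
  then have "gpath_from_to E a (a # xs @ [b]) b"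
    using xs assms by (intro gpath_from_to_Cons) auto
  then show ?thesis using that xs by blast
qed

section \<open>Images of paths in a plane drawing\<close>

locale plane_graph = simple_graph V E
  for V :: "'v set" and E :: "'v set set" +
  fixes p :: "'v \<Rightarrow> complex" and g :: "'v set \<Rightarrow> real \<Rightarrow> complex"
  assumes drawing: "plane_drawing V E p g"
begin

definition eimg :: "'v set set \<Rightarrow> complex set" where
  "eimg A = (\<Union>e\<in>A. path_image (g e))"

text \<open>A chord without its ends, so that it can lie entirely on one side of a cycle through
  these ends.\<close>

definition oimg :: "'v list \<Rightarrow> complex set" where
  "oimg xs = eimg (pedges xs) - {p (hd xs), p (last xs)}"

lemma inj_p: "inj_on p V"
  using drawing by (simp add: plane_drawing_def)

lemma arc_g: "e \<in> E \<Longrightarrow> arc (g e)"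
  using drawing by (simp add: plane_drawing_def)

lemma ends_g: "e \<in> E \<Longrightarrow> {pathstart (g e), pathfinish (g e)} = p ` e"
  using drawing by (simp add: plane_drawing_def)

lemma vertex_on_edge: "e \<in> E \<Longrightarrow> v \<in> V \<Longrightarrow> p v \<in> path_image (g e) \<longleftrightarrow> v \<in> e"
proof -
  assume e: "e \<in> E" and v: "v \<in> V"
  have "path_image (g e) \<inter> p ` V = p ` e"
    using drawing e by (simp add: plane_drawing_def)
  then have "p v \<in> path_image (g e) \<longleftrightarrow> p v \<in> p ` e"
    using v by blast
  then show ?thesis
    using inj_on_image_mem_iff[OF inj_p v] edges[OF e] by blast
qed

lemma edge_meet: "e \<in> E \<Longrightarrow> f \<in> E \<Longrightarrow> e \<noteq> f \<Longrightarrow> path_image (g e) \<inter> path_image (g f) \<subseteq> p ` (e \<inter> f)"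
  using drawing unfolding plane_drawing_def by blast

lemma finite_E: "finite E"
  using finite_V edges by (intro finite_subset[of E "Pow V"]) auto

lemma pedges_V: "pedges xs \<subseteq> E \<Longrightarrow> length xs \<ge> 2 \<Longrightarrow> set xs \<subseteq> V"
  using Union_pedges[of xs] edges by blast

lemma eimg_Un: "eimg (A \<union> B) = eimg A \<union> eimg B"
  by (auto simp: eimg_def)

lemma eimg_Int:
  assumes "A \<subseteq> E" "B \<subseteq> E" "A \<inter> B = {}"
  shows "eimg A \<inter> eimg B \<subseteq> p ` (\<Union> A \<inter> \<Union> B)"
proof
  fix z assume "z \<in> eimg A \<inter> eimg B"
  then obtain e f where "e \<in> A" "f \<in> B" "z \<in> path_image (g e) \<inter> path_image (g f)"
    by (auto simp: eimg_def)
  moreover from this have "z \<in> p ` (e \<inter> f)"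
    using edge_meet[of e f] assms by blast
  ultimately show "z \<in> p ` (\<Union> A \<inter> \<Union> B)"
    by blast
qed

lemma vertex_in_eimg: "A \<subseteq> E \<Longrightarrow> v \<in> V \<Longrightarrow> p v \<in> eimg A \<longleftrightarrow> v \<in> \<Union> A"
  using vertex_on_edge by (auto simp: eimg_def)

lemma compact_eimg: "finite A \<Longrightarrow> A \<subseteq> E \<Longrightarrow> compact (eimg A)"
  unfolding eimg_def by (intro compact_UN) (auto simp: arc_g arc_imp_path compact_path_image)

lemma edge_arc:
  assumes "{x, y} \<in> E"
  obtains c where "arc c" "pathstart c = p x" "pathfinish c = p y" "path_image c = path_image (g {x, y})"
proof -
  have "{pathstart (g {x, y}), pathfinish (g {x, y})} = {p x, p y}"
    using ends_g[OF assms] by simp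
  then consider "pathstart (g {x, y}) = p x" "pathfinish (g {x, y}) = p y"
    | "pathstart (g {x, y}) = p y" "pathfinish (g {x, y}) = p x"
    by (auto simp: doubleton_eq_iff)
  then show ?thesis
  proof cases
    case 1 then show ?thesis using that arc_g[OF assms] by blast
  next
    case 2
    then show ?thesis
      using that[of "reversepath (g {x, y})"] arc_g[OF assms] by (simp add: arc_reversepath)
  qed
qed

lemma gpath_arc:
  assumes "gpath E xs" "length xs \<ge> 2"
  shows "\<exists>c. arc c \<and> pathstart c = p (hd xs) \<and> pathfinish c = p (last xs) \<and> path_image c = eimg (pedges xs)"
  using assms
proof (induction xs rule: pedges.induct)
  case (1 x y zs)
  then have xy: "{x, y} \<in> E"
    by (simp add: gpath_def)
  obtain c where c: "arc c" "pathstart c = p x" "pathfinish c = p y" "path_image c = path_image (g {x, y})"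
    using edge_arc[OF xy] .
  show ?case
  proof (cases zs)
    case Nil
    then show ?thesis using c by (intro exI[of _ c]) (simp add: eimg_def)
  next
    case (Cons z ws)
    obtain d where d: "arc d" "pathstart d = p y" "pathfinish d = p (last (y # zs))"
        "path_image d = eimg (pedges (y # zs))"
      using 1 Cons by (auto simp: gpath_def)
    have "{x, y} \<notin> pedges (y # zs)"
      using 1 pedges_subset_set[of "{x, y}" "y # zs"] by (auto simp: gpath_def)
    then have "eimg {{x, y}} \<inter> eimg (pedges (y # zs)) \<subseteq> p ` (\<Union> {{x, y}} \<inter> \<Union> (pedges (y # zs)))"
      using 1 by (intro eimg_Int) (auto simp: gpath_def)
    also have "\<dots> \<subseteq> {p y}"
      using 1 Union_pedges_subset[of "y # zs"] by (auto simp: gpath_def)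
    finally have "path_image c \<inter> path_image d \<subseteq> {pathstart d}"
      using c d by (simp add: eimg_def)
    then have "arc (c +++ d)"
      using c d by (intro arc_join) auto
    then show ?thesis
      using c d by (intro exI[of _ "c +++ d"]) (simp add: path_image_join eimg_def)
  qed
qed auto

text \<open>A common edge would have to be \<open>{a, b}\<close>, but a path with an inner vertex
  does not contain the edge joining its ends.\<close>

lemma gpath_disjoint_edges:
  assumes "gpath_from_to E a xs b" "x \<in> set xs - {a, b}" "set xs \<inter> set ys \<subseteq> {a, b}" "pedges ys \<subseteq> E"
  shows "pedges xs \<inter> pedges ys = {}"
proof -
  have "e \<notin> pedges ys" if e: "e \<in> pedges xs" for e
  proof
    assume "e \<in> pedges ys"
    then have "e \<subseteq> {a, b}"
      using pedges_subset_set e assms(3) by blast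
    moreover have "card e = 2"
      using edges \<open>e \<in> pedges ys\<close> assms(4) by blast
    ultimately have "e = {a, b}"
      by (intro card_seteq) (auto simp: card_insert_if)
    then show False
      using ends_notin_pedges[of xs] gpath_from_to_length3[OF assms(1,2)] assms(1) e
      by (auto simp: gpath_from_to_def gpath_def)
  qed
  then show ?thesis by blast
qed

lemma gpath_image_Int:
  assumes "gpath_from_to E a xs b" "x \<in> set xs - {a, b}" "set xs \<inter> set ys = {a, b}" "gpath E ys" "length ys \<ge> 2"
  shows "eimg (pedges xs) \<inter> eimg (pedges ys) = {p a, p b}"
proof
  have sub: "pedges xs \<subseteq> E" "pedges ys \<subseteq> E"
    using assms by (auto simp: gpath_def gpath_from_to_def)
  have len: "length xs \<ge> 3"
    using gpath_from_to_length3[OF assms(1,2)] .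
  show "eimg (pedges xs) \<inter> eimg (pedges ys) \<subseteq> {p a, p b}"
    using eimg_Int[OF sub] gpath_disjoint_edges[OF assms(1,2)] assms(3) sub
      Union_pedges[of xs] Union_pedges[OF assms(5)] len by auto
  have "set xs \<subseteq> V"
    using pedges_V[OF sub(1)] len by auto
  moreover have "a \<in> set xs" "b \<in> set xs" "a \<in> set ys" "b \<in> set ys"
    using assms(3) by blast+
  ultimately show "{p a, p b} \<subseteq> eimg (pedges xs) \<inter> eimg (pedges ys)"
    using vertex_in_eimg[OF sub(1)] vertex_in_eimg[OF sub(2)] Union_pedges[of xs]
      Union_pedges[OF assms(5)] len by (simp add: subset_iff)
qed

lemma oimg_Int:
  assumes "gpath_from_to E a xs b" "A \<subseteq> E" "pedges xs \<inter> A = {}" "set xs \<inter> \<Union> A \<subseteq> {a, b}"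
  shows "oimg xs \<inter> eimg A = {}"
proof -
  have "eimg (pedges xs) \<inter> eimg A \<subseteq> p ` (\<Union> (pedges xs) \<inter> \<Union> A)"
    using assms by (intro eimg_Int) (auto simp: gpath_from_to_def gpath_def)
  also have "\<dots> \<subseteq> p ` {a, b}"
    using Union_pedges_subset[of xs] assms(4) by (intro image_mono) blast
  finally show ?thesis
    using assms(1) by (auto simp: oimg_def gpath_from_to_def)
qed

lemma connected_oimg:
  assumes "gpath_from_to E a xs b" "a \<noteq> b"
  shows "connected (oimg xs)" "oimg xs \<noteq> {}" "p a \<in> closure (oimg xs)" "p b \<in> closure (oimg xs)"
proof -
  obtain c where c: "arc c" "pathstart c = p a" "pathfinish c = p b" "path_image c = eimg (pedges xs)"
    using gpath_arc[of xs] gpath_from_to_length[OF assms] assms by (auto simp: gpath_from_to_def)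
  have o: "oimg xs = path_image c - {pathstart c, pathfinish c}"
    using c assms by (auto simp: oimg_def gpath_from_to_def)
  show "connected (oimg xs)" "oimg xs \<noteq> {}"
    unfolding o using connected_simple_path_endless nonempty_simple_path_endless c(1) arc_imp_simple_path
    by metis+
  show "p a \<in> closure (oimg xs)" "p b \<in> closure (oimg xs)"
    using closure_arc_endless[OF c(1)] c unfolding o
    by (metis pathstart_in_path_image pathfinish_in_path_image subsetD)+
qed

text \<open>The chord principle for a cycle made of \<open>A1\<close> and \<open>A2\<close>: the
  ends of \<open>A3\<close> separate those of \<open>B\<close> on it. Sides are stated for open arcs
  because a chord may be a single edge and have no inner vertex.\<close>

lemma gpath_crossing:
  assumes A1: "gpath_from_to E a A1 b" and A2: "gpath_from_to E a A2 b" and A3: "gpath_from_to E a A3 b"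
    and B: "gpath_from_to E x B y"
    and x: "x \<in> set A1 - {a, b}" and y: "y \<in> set A2 - {a, b}"
    and "set A1 \<inter> set A2 = {a, b}" "set A1 \<inter> set A3 = {a, b}" "set A2 \<inter> set A3 = {a, b}"
    and disj: "set B \<inter> set A1 = {x}" "set B \<inter> set A2 = {y}" "set B \<inter> set A3 = {}"
  shows "(oimg A3 \<subseteq> inside (eimg (pedges A1 \<union> pedges A2))) \<noteq>
         (oimg B \<subseteq> inside (eimg (pedges A1 \<union> pedges A2)))"
proof -
  have sub: "pedges A1 \<subseteq> E" "pedges A2 \<subseteq> E" "pedges A3 \<subseteq> E" "pedges B \<subseteq> E"
    using A1 A2 A3 B by (auto simp: gpath_from_to_def gpath_def)
  have len: "length A1 \<ge> 3" "length A2 \<ge> 3"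
    using gpath_from_to_length3[OF A1 x] gpath_from_to_length3[OF A2 y] .
  have ab: "a \<noteq> b"
  proof
    assume "a = b"
    then have "hd A1 = last A1" "distinct A1"
      using A1 by (auto simp: gpath_from_to_def gpath_def)
    then show False using len(1) by (cases A1) (auto split: if_splits)
  qed
  have len3: "length A3 \<ge> 2"
    using gpath_from_to_length[OF A3 ab] .
  have xy: "x \<noteq> y"
    using x y assms(7) by blast
  have inV: "set A1 \<subseteq> V" "set A2 \<subseteq> V"
    using pedges_V sub len by auto
  obtain c1 where c1: "arc c1" "pathstart c1 = p a" "pathfinish c1 = p b" "path_image c1 = eimg (pedges A1)"
    using gpath_arc[of A1] len A1 by (auto simp: gpath_from_to_def)
  obtain c2 where c2: "arc c2" "pathstart c2 = p a" "pathfinish c2 = p b" "path_image c2 = eimg (pedges A2)"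
    using gpath_arc[of A2] len A2 by (auto simp: gpath_from_to_def)
  obtain c3 where c3: "arc c3" "pathstart c3 = p a" "pathfinish c3 = p b" "path_image c3 = eimg (pedges A3)"
    using gpath_arc[of A3] len3 A3 by (auto simp: gpath_from_to_def)
  have U: "\<Union> (pedges A1) = set A1" "\<Union> (pedges A2) = set A2" "\<Union> (pedges A3) = set A3"
    using Union_pedges[of A1] Union_pedges[of A2] Union_pedges[of A3] len len3 by linarith+
  have dis: "pedges B \<inter> pedges A = {}" if s: "set B \<inter> set A \<subseteq> {z}" and A: "pedges A \<subseteq> E" for z A
  proof -
    have "card e \<noteq> 2" if "e \<in> pedges B" "e \<in> pedges A" for e
    proof -
      have "e \<subseteq> {z}"
        using pedges_subset_set that s by blast
      then show ?thesis using card_mono[of "{z}" e] by auto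
    qed
    then show ?thesis using A edges by blast
  qed
  have "pedges B \<inter> (pedges A1 \<union> pedges A2 \<union> pedges A3) = {}"
    using dis[of A1 x] dis[of A2 y] dis[of A3 x] sub disj by blast
  moreover have "set B \<inter> \<Union> (pedges A1 \<union> pedges A2 \<union> pedges A3) \<subseteq> {x, y}"
    using disj unfolding Union_Un_distrib U by blast
  ultimately have oB: "oimg B \<inter> eimg (pedges A1 \<union> pedges A2 \<union> pedges A3) = {}"
    using sub by (intro oimg_Int[OF B]) auto
  have abV: "a \<in> V" "b \<in> V" "x \<in> V" "y \<in> V"
    using inV x y gpath_from_to_in_set[OF A1] by blast+
  have xm: "p x \<in> path_image c1 - {p a, p b}"
    using vertex_in_eimg[OF sub(1) abV(3)] x abV unfolding c1(4) U by (simp add: inj_on_eq_iff[OF inj_p])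
  have ym: "p y \<in> path_image c2 - {p a, p b}"
    using vertex_in_eimg[OF sub(2) abV(4)] y abV unfolding c2(4) U by (simp add: inj_on_eq_iff[OF inj_p])
  have ints: "path_image c1 \<inter> path_image c2 = {p a, p b}" "path_image c1 \<inter> path_image c3 = {p a, p b}"
     "path_image c2 \<inter> path_image c3 = {p a, p b}"
    unfolding c1(4) c2(4) c3(4)
    using gpath_image_Int[OF A1 x assms(7)] gpath_image_Int[OF A1 x assms(8)]
      gpath_image_Int[OF A2 y assms(9)] A2 A3 len len3
    by (auto simp only: gpath_from_to_def)
  have "(path_image c3 - {p a, p b} \<subseteq> inside (path_image c1 \<union> path_image c2)) \<noteq>
         (oimg B \<subseteq> inside (path_image c1 \<union> path_image c2))"
    by (rule theta_crossing[OF c1(1-3) c2(1-3) c3(1-3) ints connected_oimg(1)[OF B xy] _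
          connected_oimg(3)[OF B xy] xm connected_oimg(4)[OF B xy] ym])
       (use oB in \<open>simp add: c1(4) c2(4) c3(4) eimg_Un\<close>)
  moreover have "path_image c3 - {p a, p b} = oimg A3"
    using A3 by (simp add: oimg_def c3(4) gpath_from_to_def)
  ultimately show ?thesis
    unfolding eimg_Un c1(4) c2(4) by blast
qed

section \<open>Sides of a closed curve in the drawing\<close>

lemma side_connected:
  assumes "connected S" "S \<inter> eimg C = {}" "C \<subseteq> E" "finite C" "u \<in> S" "w \<in> S"
  shows "u \<in> inside (eimg C) \<longleftrightarrow> w \<in> inside (eimg C)"
proof -
  have cl: "closed (eimg C)"
    using compact_eimg assms compact_imp_closed by blast
  have "S \<subseteq> inside (eimg C) \<union> outside (eimg C)"
    using assms(2) inside_Un_outside[of "eimg C"] by blast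
  then have "inside (eimg C) \<inter> S = {} \<or> outside (eimg C) \<inter> S = {}"
    using connectedD[OF assms(1) open_inside[OF cl] open_outside[OF cl]]
      inside_Int_outside[of "eimg C"] by blast
  then show ?thesis
    using \<open>S \<subseteq> inside (eimg C) \<union> outside (eimg C)\<close> assms(5,6) inside_Int_outside[of "eimg C"]
    by blast
qed

text \<open>Reads the side of a chord off at any inner vertex, which is how a chord is compared with
  the connected set it runs through.\<close>

lemma side_oimg:
  assumes "gpath_from_to E a xs b" "C \<subseteq> E" "set xs \<inter> \<Union> C \<subseteq> {a, b}" "z \<in> set xs - {a, b}"
  shows "oimg xs \<subseteq> inside (eimg C) \<longleftrightarrow> p z \<in> inside (eimg C)"
proof -
  have len: "length xs \<ge> 3"
    using gpath_from_to_length3[OF assms(1,4)] .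
  have sub: "pedges xs \<subseteq> E"
    using assms(1) by (auto simp: gpath_from_to_def gpath_def)
  have V: "set xs \<subseteq> V"
    using pedges_V sub len by auto
  have ab: "a \<noteq> b"
  proof
    assume "a = b"
    then have "hd xs = last xs" "distinct xs"
      using assms(1) by (auto simp: gpath_from_to_def gpath_def)
    then show False using len by (cases xs) (auto split: if_splits)
  qed
  have "e \<notin> C" if e: "e \<in> pedges xs" for e
  proof
    assume "e \<in> C"
    then have "e \<subseteq> {a, b}" "card e = 2"
      using pedges_subset_set[OF e] assms(2,3) edges by blast+
    then have "e = {a, b}"
      using card_subset_eq[of "{a, b}" e] ab by auto
    then show False
      using ends_notin_pedges[of xs] len assms(1) e by (auto simp: gpath_from_to_def gpath_def)
  qed
  then have o: "oimg xs \<inter> eimg C = {}"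
    using oimg_Int[OF assms(1,2) _ assms(3)] by blast
  have ends: "hd xs = a" "last xs = b" "a \<in> V" "b \<in> V"
    using assms(1) V gpath_from_to_in_set[OF assms(1)] by (auto simp: gpath_from_to_def)
  then have z: "p z \<in> oimg xs"
    using vertex_in_eimg[OF sub, of z] Union_pedges[of xs] len assms(4) V
    by (auto simp: oimg_def inj_on_eq_iff[OF inj_p])
  show ?thesis
  proof
    assume "p z \<in> inside (eimg C)"
    then have "w \<in> inside (eimg C)" if "w \<in> oimg xs" for w
      using side_connected[OF connected_oimg(1)[OF assms(1) ab] o assms(2) finite_subset[OF assms(2) finite_E] z that]
      by simp
    then show "oimg xs \<subseteq> inside (eimg C)" by blast
  qed (use z in blast)
qed

lemma side_gconnected:
  assumes "gconnected E S" "C \<subseteq> E" "S \<inter> \<Union> C = {}" "u \<in> S" "w \<in> S"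
  shows "p u \<in> inside (eimg C) \<longleftrightarrow> p w \<in> inside (eimg C)"
proof (cases "u = w")
  case False
  obtain xs where xs: "gpath_from_to E u xs w" "set xs \<subseteq> S"
    using assms(1,4,5) unfolding gconnected_def by blast
  have len: "length xs \<ge> 2"
    using gpath_from_to_length[OF xs(1) False] .
  have sub: "pedges xs \<subseteq> E"
    using xs(1) by (auto simp: gpath_from_to_def gpath_def)
  obtain c where c: "arc c" "pathstart c = p u" "pathfinish c = p w" "path_image c = eimg (pedges xs)"
    using gpath_arc[of xs] len xs(1) by (auto simp: gpath_from_to_def)
  have "e \<notin> C" if "e \<in> pedges xs" for e
  proof -
    have "e \<subseteq> S" "e \<noteq> {}"
      using that edges[of e] sub pedges_subset_set[OF that] xs(2) by auto
    then show ?thesis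
      using assms(3) by blast
  qed
  then have "pedges xs \<inter> C = {}"
    by blast
  then have "path_image c \<inter> eimg C = {}"
    using eimg_Int[OF sub assms(2)] c(4) Union_pedges_subset[of xs] xs(2) assms(3) by blast
  then show ?thesis
    using side_connected[of "path_image c" C] c assms(2) finite_subset[OF assms(2) finite_E]
    by (metis arc_imp_path connected_path_image pathstart_in_path_image pathfinish_in_path_image)
qed simp

end

section \<open>Forbidden configurations\<close>

lemma gpath_ends_neq:
  assumes "gpath_from_to E a xs b" "x \<in> set xs - {a, b}"
  shows "a \<noteq> b"
proof
  assume "a = b"
  then have "hd xs = last xs" "distinct xs"
    using assms(1) by (auto simp: gpath_from_to_def gpath_def)
  then show False
    using gpath_from_to_length3[OF assms] by (cases xs) (auto split: if_splits)
qed

context plane_graph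
begin

lemma oimg_rev: "xs \<noteq> [] \<Longrightarrow> oimg (rev xs) = oimg xs"
  by (auto simp: oimg_def hd_rev last_rev)

text \<open>After contraction of \<open>D\<close> and \<open>Z\<close> the two parts of the K33 are
  \<open>{a, b, Z}\<close> and \<open>{x, y, D}\<close>. The chord from \<open>a\<close> to
  \<open>b\<close> through \<open>D\<close> and the chord from \<open>x\<close> to \<open>y\<close>
  through \<open>Z\<close> have interleaving ends, so they lie on different sides of the cycle. But
  \<open>D \<union> Z\<close> is connected and avoids the cycle.\<close>

lemma no_K33:
  assumes A1: "gpath_from_to E a A1 b" and A2: "gpath_from_to E a A2 b"
    and Int: "set A1 \<inter> set A2 = {a, b}"
    and x: "x \<in> set A1 - {a, b}" and y: "y \<in> set A2 - {a, b}"
    and D: "gconnected E D" "D \<inter> (set A1 \<union> set A2) = {}"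
    and Z: "gconnected E Z" "Z \<inter> (set A1 \<union> set A2) = {}" "D \<inter> Z = {}"
    and DA: "d1 \<in> D" "d2 \<in> D" "{a, d1} \<in> E" "{b, d2} \<in> E"
    and ZA: "z1 \<in> Z" "z2 \<in> Z" "{x, z1} \<in> E" "{y, z2} \<in> E"
    and DZ: "d \<in> D" "z \<in> Z" "{d, z} \<in> E"
  shows False
proof -
  have ab: "a \<noteq> b"
    using gpath_ends_neq[OF A1 x] .
  have xy: "x \<noteq> y"
    using x y Int by blast
  have abA: "a \<in> set A1" "b \<in> set A1" "a \<in> set A2" "b \<in> set A2"
    using gpath_from_to_in_set[OF A1] gpath_from_to_in_set[OF A2] by auto
  then have nD: "a \<notin> D" "b \<notin> D" "x \<notin> Z" "y \<notin> Z"
    using D Z x y by blast+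
  obtain P where P: "gpath_from_to E a (a # P @ [b]) b" "set P \<subseteq> D" "gpath_from_to E d1 P d2"
    using gpath_via[OF D(1) DA nD(1,2) ab] .
  obtain Q where Q: "gpath_from_to E x (x # Q @ [y]) y" "set Q \<subseteq> Z" "gpath_from_to E z1 Q z2"
    using gpath_via[OF Z(1) ZA nD(3,4) xy] .
  define C where "C = pedges A1 \<union> pedges A2"
  have UC: "\<Union> C = set A1 \<union> set A2"
    unfolding C_def Union_Un_distrib
    using Union_pedges[of A1] Union_pedges[of A2] gpath_from_to_length3[OF A1 x]
      gpath_from_to_length3[OF A2 y] by simp
  have CE: "C \<subseteq> E"
    using A1 A2 by (auto simp: C_def gpath_from_to_def gpath_def)
  have "(oimg (a # P @ [b]) \<subseteq> inside (eimg C)) \<noteq> (oimg (x # Q @ [y]) \<subseteq> inside (eimg C))"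
    unfolding C_def
  proof (rule gpath_crossing[OF A1 A2 P(1) Q(1) x y Int])
    show "set A1 \<inter> set (a # P @ [b]) = {a, b}" "set A2 \<inter> set (a # P @ [b]) = {a, b}"
      using abA P(2) D(2) by auto
    show "set (x # Q @ [y]) \<inter> set A1 = {x}" "set (x # Q @ [y]) \<inter> set A2 = {y}"
      using x y Int Q(2) Z(2) by auto
    show "set (x # Q @ [y]) \<inter> set (a # P @ [b]) = {}"
      using x y abA P(2) Q(2) D(2) Z(2,3) by auto
  qed
  moreover have "oimg (a # P @ [b]) \<subseteq> inside (eimg C) \<longleftrightarrow> p d1 \<in> inside (eimg C)"
  proof (rule side_oimg[OF P(1) CE])
    show "set (a # P @ [b]) \<inter> \<Union> C \<subseteq> {a, b}"
      using P(2) D(2) unfolding UC by auto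
    show "d1 \<in> set (a # P @ [b]) - {a, b}"
      using gpath_from_to_in_set[OF P(3)] DA(1) nD by auto
  qed
  moreover have "oimg (x # Q @ [y]) \<subseteq> inside (eimg C) \<longleftrightarrow> p z1 \<in> inside (eimg C)"
  proof (rule side_oimg[OF Q(1) CE])
    show "set (x # Q @ [y]) \<inter> \<Union> C \<subseteq> {x, y}"
      using Q(2) Z(2) unfolding UC by auto
    show "z1 \<in> set (x # Q @ [y]) - {x, y}"
      using gpath_from_to_in_set[OF Q(3)] ZA(1) nD by auto
  qed
  moreover have "p d1 \<in> inside (eimg C) \<longleftrightarrow> p z1 \<in> inside (eimg C)"
    using D(2) Z(2) DA(1) ZA(1) by (intro side_gconnected[OF gconnected_Un[OF D(1) Z(1) DZ] CE]) (auto simp: UC)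
  ultimately show False
    by blast
qed

text \<open>The five branch sets are \<open>a\<close>, \<open>b\<close>, \<open>c\<close>,
  \<open>D\<close>, \<open>Z\<close>. On the cycle formed by \<open>A\<close> and a path
  \<open>P\<close> through \<open>D\<close>, four chords are compared: \<open>Q\<close>;
  \<open>T\<close> from \<open>c\<close> to \<open>P\<close> within \<open>D\<close>;
  \<open>S\<close> from \<open>c\<close> to \<open>P\<close> starting through \<open>Z\<close>; and
  \<open>R\<close> from \<open>a\<close> to \<open>b\<close> through \<open>Z\<close>.
  \<open>Q\<close> is opposite to \<open>T\<close> and to \<open>S\<close>, and \<open>T\<close> is
  opposite to \<open>R\<close>, while \<open>R\<close> and \<open>S\<close> are on the same side
  because both meet \<open>Z\<close>. These relations contradict each other.\<close>

lemma no_K5: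
  assumes Q: "gpath_from_to E a Q b" and A: "gpath_from_to E a (a # M1 @ c # M2 @ [b]) b"
    and Int: "set Q \<inter> set (a # M1 @ c # M2 @ [b]) = {a, b}"
    and D: "gconnected E D" "D \<inter> (set Q \<union> set (a # M1 @ c # M2 @ [b])) = {}"
    and Z: "gconnected E Z" "Z \<inter> (set Q \<union> set (a # M1 @ c # M2 @ [b])) = {}" "D \<inter> Z = {}"
    and DA: "da \<in> D" "db \<in> D" "dc \<in> D" "{a, da} \<in> E" "{b, db} \<in> E" "{c, dc} \<in> E"
    and ZA: "za \<in> Z" "zb \<in> Z" "zc \<in> Z" "{a, za} \<in> E" "{b, zb} \<in> E" "{c, zc} \<in> E"
    and DZ: "d \<in> D" "z \<in> Z" "{d, z} \<in> E"
  shows False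
proof -
  let ?A = "a # M1 @ c # M2 @ [b]"
  have dist: "distinct ?A"
    using A by (simp add: gpath_from_to_def gpath_def)
  have ab: "a \<noteq> b"
    using dist by auto
  have n: "a \<notin> D" "b \<notin> D" "c \<notin> D" "a \<notin> Z" "b \<notin> Z" "c \<notin> Z"
    using D(2) Z(2) by auto
  have abQ: "a \<in> set Q" "b \<in> set Q" "c \<notin> set Q"
    using gpath_from_to_in_set[OF Q] dist Int by auto
  obtain P where P: "gpath_from_to E a (a # P @ [b]) b" "set P \<subseteq> D" "gpath_from_to E da P db"
    using gpath_via[OF D(1) DA(1,2,4,5) n(1,2) ab] .
  have Pne: "da \<in> set P"
    using gpath_from_to_in_set[OF P(3)] by simp
  obtain R where R: "gpath_from_to E a (a # R @ [b]) b" "set R \<subseteq> Z" "gpath_from_to E za R zb"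
    using gpath_via[OF Z(1) ZA(1,2,4,5) n(4,5) ab] .
  have "set P \<inter> D \<noteq> {}" "set P \<inter> (D \<union> Z) \<noteq> {}"
    using Pne P(2) by auto
  obtain T x where T: "gpath_from_to E dc T x" "set T \<subseteq> D" "x \<in> set P" "set T \<inter> set P = {x}"
    using gpath_first_hit[OF D(1) DA(3) \<open>set P \<inter> D \<noteq> {}\<close>] .
  have zcDZ: "zc \<in> D \<union> Z"
    using ZA(3) by blast
  \<comment> \<open>As \<open>P\<close> lies in \<open>D\<close>, this path has to leave
    \<open>Z\<close> before it ends; so the chord \<open>c # S\<close> has an inner vertex in
    \<open>Z\<close>.\<close>
  obtain S y where S: "gpath_from_to E zc S y" "set S \<subseteq> D \<union> Z" "y \<in> set P" "set S \<inter> set P = {y}"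
    using gpath_first_hit[OF gconnected_Un[OF D(1) Z(1) DZ] zcDZ \<open>set P \<inter> (D \<union> Z) \<noteq> {}\<close>] .
  have T': "gpath_from_to E c (c # T) x"
    using T n DA by (intro gpath_from_to_Cons[OF T(1)]) auto
  have S': "gpath_from_to E c (c # S) y"
    using S n ZA by (intro gpath_from_to_Cons[OF S(1)]) auto
  have ne: "T \<noteq> []" "S \<noteq> []"
    using T(1) S(1) by (auto simp: gpath_from_to_def)
  define C where "C = pedges (a # P @ [b]) \<union> pedges ?A"
  have UC: "\<Union> C = insert a (insert b (set P)) \<union> set ?A"
    unfolding C_def Union_Un_distrib
    using Union_pedges[of "a # P @ [b]"] Union_pedges[of ?A] by simp
  have CE: "C \<subseteq> E"
    using A P(1) by (auto simp: C_def gpath_from_to_def gpath_def)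
  have xin: "x \<in> set (a # P @ [b]) - {a, b}" "y \<in> set (a # P @ [b]) - {a, b}"
    using T(3) S(3) P(2) n by auto
  have cin: "c \<in> set ?A - {a, b}"
    using dist by auto
  have PA: "set (a # P @ [b]) \<inter> set ?A = {a, b}"
    using P(2) D(2) by auto
  have PQ: "set (a # P @ [b]) \<inter> set Q = {a, b}" "set ?A \<inter> set Q = {a, b}"
    using P(2) D(2) abQ Int by auto
  have cross1: "(oimg Q \<subseteq> inside (eimg C)) \<noteq> (oimg (rev (c # T)) \<subseteq> inside (eimg C))"
    unfolding C_def
  proof (rule gpath_crossing[OF P(1) A Q gpath_from_to_rev[OF T'] xin(1) cin PA PQ])
    show "set (rev (c # T)) \<inter> set (a # P @ [b]) = {x}"
      using T n cin P(2) by auto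
    show "set (rev (c # T)) \<inter> set ?A = {c}"
      using T(2) D(2) by auto
    show "set (rev (c # T)) \<inter> set Q = {}"
      using T(2) D(2) abQ by auto
  qed
  have cross2: "(oimg Q \<subseteq> inside (eimg C)) \<noteq> (oimg (rev (c # S)) \<subseteq> inside (eimg C))"
    unfolding C_def
  proof (rule gpath_crossing[OF P(1) A Q gpath_from_to_rev[OF S'] xin(2) cin PA PQ])
    show "set (rev (c # S)) \<inter> set (a # P @ [b]) = {y}"
      using S n cin P(2) by auto
    show "set (rev (c # S)) \<inter> set ?A = {c}"
      using S(2) D(2) Z(2) by auto
    show "set (rev (c # S)) \<inter> set Q = {}"
      using S(2) D(2) Z(2) abQ by auto
  qed
  obtain P1 P2 where P12: "P = P1 @ x # P2"
    using split_list[OF T(3)] by blast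
  have pa: "gpath_from_to E a (a # P1 @ [x]) x" "gpath_from_to E x (x # P2 @ [b]) b"
    using P(1) gpath_from_to_append[of E a "a # P1" x "P2 @ [b]" b] by (auto simp: P12)
  have aa: "gpath_from_to E a (a # M1 @ [c]) c" "gpath_from_to E c (c # M2 @ [b]) b"
    using A gpath_from_to_append[of E a "a # M1" c "M2 @ [b]" b] by auto
  let ?R1 = "c # rev M1 @ a # P1 @ [x]" and ?R2 = "c # M2 @ b # rev P2 @ [x]"
  have setP: "set P1 \<subseteq> D" "set P2 \<subseteq> D" "x \<in> D"
    using P(2) by (auto simp: P12)
  have distP: "x \<notin> set P1" "x \<notin> set P2" "set P1 \<inter> set P2 = {}"
    using P(1) by (auto simp: P12 gpath_from_to_def gpath_def)
  have R1: "gpath_from_to E c ?R1 x"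
    using gpath_from_to_append[of E c "c # rev M1" a "P1 @ [x]" x] pa(1) gpath_from_to_rev[OF aa(1)]
      setP n D(2) by auto
  have R2: "gpath_from_to E c ?R2 x"
    using gpath_from_to_append[of E c "c # M2" b "rev P2 @ [x]" x] aa(2) gpath_from_to_rev[OF pa(2)]
      setP n D(2) by auto
  have CR: "C = pedges ?R1 \<union> pedges ?R2"
  proof -
    have "pedges ?A = pedges (a # M1 @ [c]) \<union> pedges (c # M2 @ [b])"
      using pedges_append[of "a # M1" c "M2 @ [b]"] by simp
    moreover have "pedges (a # P @ [b]) = pedges (a # P1 @ [x]) \<union> pedges (x # P2 @ [b])"
      using pedges_append[of "a # P1" x "P2 @ [b]"] by (simp add: P12)
    moreover have "pedges ?R1 = pedges (a # M1 @ [c]) \<union> pedges (a # P1 @ [x])"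
      using pedges_append[of "c # rev M1" a "P1 @ [x]"] pedges_rev[of "a # M1 @ [c]"] by simp
    moreover have "pedges ?R2 = pedges (c # M2 @ [b]) \<union> pedges (x # P2 @ [b])"
      using pedges_append[of "c # M2" b "rev P2 @ [x]"] pedges_rev[of "x # P2 @ [b]"] by simp
    ultimately show ?thesis
      unfolding C_def by blast
  qed
  have cross3: "(oimg (c # T) \<subseteq> inside (eimg C)) \<noteq> (oimg (a # R @ [b]) \<subseteq> inside (eimg C))"
    unfolding CR
  proof (rule gpath_crossing[OF R1 R2 T' R(1)])
    show "a \<in> set ?R1 - {c, x}" "b \<in> set ?R2 - {c, x}"
      using dist n setP by auto
    show "set ?R1 \<inter> set ?R2 = {c, x}"
      using dist distP setP D(2) by auto
    show "set ?R1 \<inter> set (c # T) = {c, x}" "set ?R2 \<inter> set (c # T) = {c, x}"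
      using T(2-4) D(2) distP unfolding P12 by auto
    show "set (a # R @ [b]) \<inter> set ?R1 = {a}" "set (a # R @ [b]) \<inter> set ?R2 = {b}"
      using R(2) Z(2,3) setP dist n by auto
    show "set (a # R @ [b]) \<inter> set (c # T) = {}"
      using R(2) Z(2,3) T(2) dist n by auto
  qed
  have "oimg (a # R @ [b]) \<subseteq> inside (eimg C) \<longleftrightarrow> p za \<in> inside (eimg C)"
  proof (rule side_oimg[OF R(1) CE])
    show "set (a # R @ [b]) \<inter> \<Union> C \<subseteq> {a, b}"
      using R(2) Z(2,3) P(2) unfolding UC by auto
    show "za \<in> set (a # R @ [b]) - {a, b}"
      using gpath_from_to_in_set[OF R(3)] ZA(1) n by auto
  qed
  moreover have "oimg (c # S) \<subseteq> inside (eimg C) \<longleftrightarrow> p zc \<in> inside (eimg C)"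
  proof (rule side_oimg[OF S' CE])
    show "set (c # S) \<inter> \<Union> C \<subseteq> {c, y}"
      using S(2,4) Z(2) D(2) unfolding UC by auto
    show "zc \<in> set (c # S) - {c, y}"
      using gpath_from_to_in_set[OF S(1)] ZA(3) n S(3) P(2) Z(3) by auto
  qed
  moreover have "p za \<in> inside (eimg C) \<longleftrightarrow> p zc \<in> inside (eimg C)"
    using Z ZA P(2) by (intro side_gconnected[OF Z(1) CE]) (auto simp: UC)
  ultimately show False
    using cross1 cross2 cross3 oimg_rev[of "c # T"] oimg_rev[of "c # S"] by auto
qed

end

section \<open>Removable vertices and separations\<close>

definition gcycle :: "'v set set \<Rightarrow> 'v list \<Rightarrow> bool" where
  "gcycle E xs \<longleftrightarrow> gpath E xs \<and> length xs \<ge> 3 \<and> {hd xs, last xs} \<in> E"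

definition nbhd :: "'v set set \<Rightarrow> 'v set \<Rightarrow> 'v set" where
  "nbhd E S = {w. \<exists>z\<in>S. {z, w} \<in> E}"

lemma nbhd_iff: "w \<in> nbhd E S \<longleftrightarrow> (\<exists>z\<in>S. {w, z} \<in> E)"
  by (simp add: nbhd_def insert_commute[of w])

text \<open>The second arc runs backwards from \<open>a\<close> to the head of the list, over the
  closing edge to the last entry, and backwards again to \<open>b\<close>.\<close>

lemma gcycle_split_aux:
  assumes "gcycle E (us @ a # vs @ b # ws)"
  shows "gpath_from_to E a (a # vs @ [b]) b" "gpath_from_to E a (a # rev us @ rev ws @ [b]) b"
proof -
  let ?xs = "us @ a # vs @ b # ws"
  have g: "gpath E ?xs" and close: "{hd ?xs, last ?xs} \<in> E"
    using assms by (auto simp: gcycle_def)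
  have g1: "gpath E (us @ [a])" "gpath E (a # vs @ b # ws)"
    using g gpath_append_iff[of E us a "vs @ b # ws"] by auto
  then have g2: "gpath E (a # vs @ [b])" "gpath E (b # ws)"
    using gpath_append_iff[of E "a # vs" b ws] by auto
  show "gpath_from_to E a (a # vs @ [b]) b"
    using g2(1) by (simp add: gpath_from_to_def)
  have "pedges ((a # rev us) @ (rev ws @ [b])) =
      insert {last (a # rev us), hd (rev ws @ [b])} (pedges (a # rev us) \<union> pedges (rev ws @ [b]))"
    by (rule pedges_append2) auto
  moreover have "last (a # rev us) = hd ?xs" "hd (rev ws @ [b]) = last ?xs"
    by (cases us; simp add: last_rev) (cases ws rule: rev_cases; simp)
  moreover have "pedges (a # rev us) \<subseteq> E" "pedges (rev ws @ [b]) \<subseteq> E"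
    using g1(1) g2(2) pedges_rev[of "us @ [a]"] pedges_rev[of "b # ws"] by (auto simp: gpath_def)
  moreover have "distinct (a # rev us @ rev ws @ [b])"
    using g by (auto simp: gpath_def)
  ultimately show "gpath_from_to E a (a # rev us @ rev ws @ [b]) b"
    using close by (simp add: gpath_from_to_def gpath_def)
qed

lemma gcycle_split:
  assumes "gcycle E xs" "a \<in> set xs" "b \<in> set xs" "a \<noteq> b"
  obtains A B where "gpath_from_to E a A b" "gpath_from_to E a B b"
    "set A \<inter> set B = {a, b}" "set A \<union> set B = set xs"
proof -
  have *: "\<exists>A B. gpath_from_to E a A b \<and> gpath_from_to E a B b \<and> set A \<inter> set B = {a, b} \<and> set A \<union> set B = set xs"
    if xs: "xs = us @ a # vs @ b # ws" for us vs ws and a b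
  proof -
    have "distinct xs"
      using assms(1) by (simp add: gcycle_def gpath_def)
    then show ?thesis
      using gcycle_split_aux[of E us a vs b ws] assms(1) unfolding xs
      by (intro exI[of _ "a # vs @ [b]"] exI[of _ "a # rev us @ rev ws @ [b]"]) auto
  qed
  obtain us zs where us: "xs = us @ a # zs"
    using split_list assms(2) by metis
  show ?thesis
  proof (cases "b \<in> set zs")
    case True
    then obtain vs ws where "zs = vs @ b # ws"
      using split_list by metis
    then have "xs = us @ a # vs @ b # ws"
      using us by simp
    then show ?thesis
      using *[of us a vs b ws] that by blast
  next
    case False
    then have "b \<in> set us"
      using assms(3,4) us by auto
    then obtain ps qs where "us = ps @ b # qs"
      using split_list by metis
    then obtain A B where AB: "gpath_from_to E b A a" "gpath_from_to E b B a"
      "set A \<inter> set B = {b, a}" "set A \<union> set B = set xs"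
      using *[of ps b qs a zs] us by auto
    then show ?thesis
      using gpath_from_to_rev[OF AB(1)] gpath_from_to_rev[OF AB(2)] by (intro that[of "rev A" "rev B"]) auto
  qed
qed

lemma gconnected_gpath: "gpath E xs \<Longrightarrow> gconnected E (set xs)"
proof (induction xs rule: pedges.induct)
  case (1 x y zs)
  then have "gconnected E (set (y # zs))"
    by (simp add: gpath_def)
  then have "gconnected E (insert x (set (y # zs)))"
    using 1 by (intro gconnected_insert[of E _ y]) (auto simp: gpath_def insert_commute)
  then show ?case by simp
qed (auto simp: gconnected_singleton, simp add: gconnected_def)

lemma gpath_from_to_interior:
  assumes "gpath_from_to E a xs b" "c \<in> set xs - {a, b}"
  obtains M1 M2 where "xs = a # M1 @ c # M2 @ [b]"
proof -
  obtain ps qs where xs: "xs = ps @ c # qs"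
    using assms(2) split_list[of c xs] by blast
  have "ps \<noteq> []" "qs \<noteq> []"
    using assms xs by (auto simp: gpath_from_to_def)
  then obtain p ps' q qs' where pq: "ps = p # ps'" "qs = qs' @ [q]"
    by (cases ps; cases qs rule: rev_cases) auto
  then show ?thesis
    using assms(1) xs by (intro that[of ps' qs']) (auto simp: gpath_from_to_def)
qed

lemma gpath_from_to_no_interior:
  assumes "gpath_from_to E a xs b" "a \<noteq> b" "set xs \<subseteq> {a, b}"
  shows "{a, b} \<in> E"
proof -
  obtain x y zs where xs: "xs = x # y # zs"
    using gpath_from_to_length[OF assms(1,2)] by (auto simp: Suc_le_length_iff numeral_2_eq_2)
  then have "x = a" "y = b"
    using assms by (auto simp: gpath_from_to_def gpath_def)
  then show ?thesis
    using assms(1) xs by (simp add: gpath_from_to_def gpath_def)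
qed

text \<open>A longest path cannot be prolonged, so the neighbours of its end within \<open>K\<close>
  lie on it; a neighbour other than the second vertex closes a cycle.\<close>

lemma longest_gpath_end:
  assumes xs: "gpath E xs" "xs \<noteq> []" "set xs \<subseteq> K"
    and max: "\<And>ys. gpath E ys \<Longrightarrow> set ys \<subseteq> K \<Longrightarrow> length ys \<le> length xs"
    and E: "\<And>u. {u} \<notin> E"
  shows "nbhd E {hd xs} \<inter> K \<subseteq> set xs - {hd xs}"
    and "card (nbhd E {hd xs} \<inter> K) \<le> 1 \<or> (\<exists>ys. gcycle E ys \<and> set ys \<subseteq> K)"
proof -
  obtain u zs where xs_eq: "xs = u # zs"
    using xs(2) by (cases xs) auto
  show sub: "nbhd E {hd xs} \<inter> K \<subseteq> set xs - {hd xs}"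
  proof
    fix w assume w: "w \<in> nbhd E {hd xs} \<inter> K"
    then have uw: "{w, u} \<in> E"
      by (simp add: nbhd_iff xs_eq)
    have "w \<in> set xs"
    proof (rule ccontr)
      assume "w \<notin> set xs"
      then have "gpath E (w # xs)"
        using xs uw by (auto simp: gpath_def xs_eq)
      then show False
        using max[of "w # xs"] w xs(3) by auto
    qed
    moreover have "w \<noteq> u"
      using uw E by auto
    ultimately show "w \<in> set xs - {hd xs}"
      by (simp add: xs_eq)
  qed
  show "card (nbhd E {hd xs} \<inter> K) \<le> 1 \<or> (\<exists>ys. gcycle E ys \<and> set ys \<subseteq> K)"
  \<comment> \<open>For a path of one vertex \<open>hd zs\<close> is unspecified, which does no
    harm: its end then has no neighbours in \<open>K\<close> at all.\<close>
  proof (cases "nbhd E {hd xs} \<inter> K \<subseteq> {hd zs}")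
    case True
    then have "card (nbhd E {hd xs} \<inter> K) \<le> card {hd zs}"
      by (intro card_mono) auto
    then show ?thesis by simp
  next
    case False
    then obtain w where w: "w \<in> nbhd E {hd xs} \<inter> K" "w \<noteq> hd zs"
      by blast
    then have "w \<in> set zs"
      using sub by (auto simp: xs_eq)
    then obtain ps qs where zs: "zs = ps @ w # qs"
      using split_list by metis
    have "ps \<noteq> []"
      using w(2) zs by auto
    have "gcycle E (u # ps @ [w])"
      using xs(1) gpath_append_iff[of E "u # ps" w qs] w \<open>ps \<noteq> []\<close>
      by (cases ps) (auto simp: gcycle_def xs_eq zs nbhd_def)
    moreover have "set (u # ps @ [w]) \<subseteq> K"
      using xs(3) by (auto simp: xs_eq zs)
    ultimately show ?thesis by blast
  qed
qed

context plane_graph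
begin

lemma no_loop: "{u} \<notin> E"
  using edges[of "{u}"] by auto

text \<open>If \<open>a\<close>, \<open>b\<close>, \<open>c\<close> are three attachments, the cycle
  is cut at \<open>a\<close> and \<open>b\<close>; the arc through \<open>c\<close> and the other
  arc give a K5 with \<open>D\<close> and \<open>Z\<close>. If two attachments are not adjacent,
  both arcs between them have inner vertices, and these are adjacent to \<open>Z\<close>, which
  gives a K33.\<close>

lemma cycle_attachments:
  assumes cyc: "gcycle E xs" and Z: "gconnected E Z" "Z \<inter> set xs = {}" "set xs \<subseteq> nbhd E Z"
    and D: "gconnected E D" "D \<inter> set xs = {}" "D \<inter> Z = {}" "D \<inter> nbhd E Z \<noteq> {}"
  shows "card (nbhd E D \<inter> set xs) \<le> 2"
    and "card (nbhd E D \<inter> set xs) = 2 \<Longrightarrow> nbhd E D \<inter> set xs \<in> E"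
proof -
  let ?S = "nbhd E D \<inter> set xs"
  obtain d z where dz: "d \<in> D" "z \<in> Z" "{d, z} \<in> E"
    using D(4) by (auto simp: nbhd_iff)
  have zadj: "\<exists>z\<in>Z. {w, z} \<in> E" if "w \<in> set xs" for w
    using Z(3) that by (auto simp: nbhd_iff)
  have dadj: "\<exists>d\<in>D. {w, d} \<in> E" if "w \<in> ?S" for w
    using that by (auto simp: nbhd_iff)
  have three: False if abc: "a \<in> ?S" "b \<in> ?S" "c \<in> ?S" "a \<noteq> b" "c \<noteq> a" "c \<noteq> b" for a b c
  proof -
    have K5: False if AB: "gpath_from_to E a A b" "gpath_from_to E a B b"
      "set A \<inter> set B = {a, b}" "set A \<union> set B = set xs" "c \<in> set B" for A B
    proof -
      have "c \<in> set B - {a, b}"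
        using AB(5) abc by blast
      then obtain M1 M2 where B: "B = a # M1 @ c # M2 @ [b]"
        using gpath_from_to_interior[OF AB(2)] by blast
      obtain da db dc where d: "da \<in> D" "db \<in> D" "dc \<in> D" "{a, da} \<in> E" "{b, db} \<in> E" "{c, dc} \<in> E"
        using dadj abc(1-3) by meson
      obtain za zb zc where z: "za \<in> Z" "zb \<in> Z" "zc \<in> Z" "{a, za} \<in> E" "{b, zb} \<in> E" "{c, zc} \<in> E"
        using zadj abc(1-3) by (meson IntD2)
      show False
        using AB Z(2) D(2)
        by (intro no_K5[OF AB(1) AB(2)[unfolded B] AB(3)[unfolded B] D(1) _ Z(1) _ D(3) d z dz])
           (auto simp: B)
    qed
    obtain A B where AB: "gpath_from_to E a A b" "gpath_from_to E a B b"
      "set A \<inter> set B = {a, b}" "set A \<union> set B = set xs"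
      using gcycle_split[OF cyc] abc by blast
    then have "c \<in> set A \<or> c \<in> set B"
      using abc by blast
    then show False
      using K5[OF AB] K5[OF AB(2,1)] AB(3,4) by (auto simp: Int_commute Un_commute)
  qed
  show le2: "card ?S \<le> 2"
  proof (rule ccontr)
    assume "\<not> card ?S \<le> 2"
    then obtain T where "T \<subseteq> ?S" "card T = 3"
      using obtain_subset_with_card_n[of 3 ?S] by force
    then obtain x y z where "T = {x, y, z}" "x \<noteq> y" "y \<noteq> z" "x \<noteq> z"
      by (auto simp: card_3_iff)
    then show False
      using three[of x y z] \<open>T \<subseteq> ?S\<close> by simp
  qed
  assume "card ?S = 2"
  then obtain a b where ab: "?S = {a, b}" "a \<noteq> b"
    by (auto simp: card_2_iff)
  have abS: "a \<in> ?S" "b \<in> ?S"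
    using ab(1) by blast+
  obtain A B where AB: "gpath_from_to E a A b" "gpath_from_to E a B b"
    "set A \<inter> set B = {a, b}" "set A \<union> set B = set xs"
    using gcycle_split[OF cyc, of a b] ab abS by blast
  show "?S \<in> E"
  proof (rule ccontr)
    assume "?S \<notin> E"
    then obtain x y where xy: "x \<in> set A - {a, b}" "y \<in> set B - {a, b}"
      using gpath_from_to_no_interior[OF AB(1) ab(2)] gpath_from_to_no_interior[OF AB(2) ab(2)] ab(1) by auto
    obtain d1 d2 where d: "d1 \<in> D" "d2 \<in> D" "{a, d1} \<in> E" "{b, d2} \<in> E"
      using dadj abS by meson
    obtain z1 z2 where z: "z1 \<in> Z" "z2 \<in> Z" "{x, z1} \<in> E" "{y, z2} \<in> E"
      using zadj xy AB(4) by (metis DiffD1 UnCI)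
    show False
      using AB(4) Z(2) D(2)
      by (intro no_K33[OF AB(1-3) xy D(1) _ Z(1) _ D(3) d z dz]) auto
  qed
qed

text \<open>By \<open>nr\<close> no vertex satisfies the degree conditions of
  \<open>good_remove\<close>. The result provides the pieces \<open>D \<union> S\<close> and
  \<open>W - D\<close>, which overlap in \<open>S\<close>, for \<open>good_glue\<close>; the second
  is smaller than \<open>W\<close> because \<open>D\<close> contains the roots.\<close>

lemma removable_or_separation:
  assumes W: "W \<subseteq> V" and Z: "gconnected E Z" "Z \<inter> W = {}"
    and F: "F = nbhd E Z \<inter> W" and R: "R = {v1, v2}" "{v1, v2} \<in> E" "R \<subseteq> F" "F \<noteq> R"
    and nr: "\<And>v. v \<in> F - R \<Longrightarrow> card (nbhd E {v} \<inter> F) \<le> 2 \<Longrightarrow> \<not> card (nbhd E {v} \<inter> F - R) \<le> 1"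
  obtains D S where "R \<subseteq> D" "D \<subseteq> W" "S \<subseteq> F" "S \<inter> D = {}" "D \<union> S \<noteq> W" "card S \<le> 2"
    "card S = 2 \<Longrightarrow> S \<in> E" "nbhd E D \<inter> W \<subseteq> D \<union> S"
proof -
  define K where "K = F - R"
  have finW: "finite W"
    using finite_subset[OF W finite_V] .
  have KF: "K \<subseteq> F" "F \<subseteq> W" "K \<noteq> {}"
    using F R by (auto simp: K_def)
  have finK: "finite K"
    using finite_subset[OF KF(1)] finite_subset[OF KF(2) finW] by blast
  have v12: "v1 \<noteq> v2"
    using R(2) no_loop by auto
  define Ps where "Ps = {xs. gpath E xs \<and> set xs \<subseteq> K}"
  have bound: "length xs \<le> card K" if "xs \<in> Ps" for xs
    using that distinct_card[of xs] card_mono[OF finK, of "set xs"] by (auto simp: Ps_def gpath_def)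
  obtain k where "k \<in> K"
    using KF by blast
  then have "[k] \<in> Ps"
    by (simp add: Ps_def gpath_def)
  then obtain xs where xs: "xs \<in> Ps" "\<And>ys. ys \<in> Ps \<Longrightarrow> length ys \<le> length xs"
    using ex_has_greatest_nat[of "\<lambda>xs. xs \<in> Ps" "[k]" length "card K + 1"] bound
    by (metis less_Suc_eq_le Suc_eq_plus1)
  have ne: "xs \<noteq> []"
    using xs(2)[OF \<open>[k] \<in> Ps\<close>] by auto
  have ends: "nbhd E {hd ys} \<inter> K \<subseteq> set ys - {hd ys} \<and>
      (card (nbhd E {hd ys} \<inter> K) \<le> 1 \<or> (\<exists>ys. gcycle E ys \<and> set ys \<subseteq> K))"
    if "ys \<in> Ps" "length ys = length xs" for ys
  proof -
    have "gpath E ys" "ys \<noteq> []" "set ys \<subseteq> K"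
      using that ne by (auto simp: Ps_def)
    moreover have "\<And>zs. gpath E zs \<Longrightarrow> set zs \<subseteq> K \<Longrightarrow> length zs \<le> length ys"
      using xs(2) that(2) by (simp add: Ps_def)
    ultimately show ?thesis
      using longest_gpath_end[of E ys K] no_loop by blast
  qed
  show ?thesis
  proof (cases "\<exists>ys. gcycle E ys \<and> set ys \<subseteq> K")
    case True
    then obtain ys where ys: "gcycle E ys" "set ys \<subseteq> K"
      by blast
    \<comment> \<open>A maximal member absorbs all its neighbours in \<open>W\<close> off the cycle,
      so the remaining ones are attachments on the cycle.\<close>
    define Ds where "Ds = {D. gconnected E D \<and> R \<subseteq> D \<and> D \<subseteq> W - set ys}"
    have "gconnected E (insert v2 {v1})"
      using R(2) by (rule gconnected_insert[OF gconnected_singleton singletonI])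
    moreover have "R = insert v2 {v1}"
      using R(1) by auto
    ultimately have "gconnected E R"
      by simp
    then have "R \<in> Ds"
      using R ys KF by (auto simp: Ds_def K_def)
    moreover have "finite Ds"
      using finW by (intro finite_subset[of Ds "Pow W"]) (auto simp: Ds_def)
    ultimately obtain D where D: "D \<in> Ds" "\<And>D'. D' \<in> Ds \<Longrightarrow> D \<subseteq> D' \<Longrightarrow> D' = D"
      using finite_has_maximal[of Ds] by blast
    have Dp: "gconnected E D" "R \<subseteq> D" "D \<subseteq> W - set ys"
      using D(1) by (auto simp: Ds_def)
    let ?S = "nbhd E D \<inter> set ys"
    have "v1 \<in> D \<inter> nbhd E Z"
      using Dp(2) R F by auto
    then have att: "card ?S \<le> 2" "card ?S = 2 \<Longrightarrow> ?S \<in> E"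
      using cycle_attachments[OF ys(1) Z(1) _ _ Dp(1)] ys KF F Z(2) Dp by blast+
    have "w \<in> D \<union> ?S" if w: "w \<in> nbhd E D \<inter> W" for w
    proof (cases "w \<in> set ys")
      case False
      obtain d where "d \<in> D" "{d, w} \<in> E"
        using w by (auto simp: nbhd_def)
      then have "insert w D \<in> Ds"
        using gconnected_insert[OF Dp(1)] Dp w False by (auto simp: Ds_def)
      then have "insert w D = D"
        using D(2) by blast
      then show ?thesis by blast
    qed (use w in auto)
    \<comment> \<open>As \<open>D\<close> avoids the cycle, equality would force at least three
      cycle vertices into the attachment set.\<close>
    moreover have "D \<union> ?S \<noteq> W"
    proof
      assume "D \<union> ?S = W"
      then have "set ys \<subseteq> ?S"
        using ys KF Dp by blast
      then have "card (set ys) \<le> 2"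
        using att(1) card_mono[of ?S "set ys"] by simp
      then show False
        using ys(1) distinct_card[of ys] by (simp add: gcycle_def gpath_def)
    qed
    ultimately show ?thesis
      using att Dp ys KF by (intro that[of D ?S]) auto
  next
    case False
    \<comment> \<open>Such a vertex has at least three neighbours in \<open>F\<close> and at most
      one of them in \<open>K\<close>; so it sees both roots and exactly one vertex of
      \<open>K\<close>.\<close>
    have full: "R \<subseteq> nbhd E {u} \<and> nbhd E {u} \<inter> K \<noteq> {}" if u: "u \<in> K" "card (nbhd E {u} \<inter> K) \<le> 1" for u
    proof -
      have "\<not> card (nbhd E {u} \<inter> F) \<le> 2"
        using nr[of u] u by (auto simp: K_def Int_Diff)
      moreover have "nbhd E {u} \<inter> F = (nbhd E {u} \<inter> K) \<union> (nbhd E {u} \<inter> R)"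
        using R by (auto simp: K_def)
      ultimately have "card (nbhd E {u} \<inter> K) + card (nbhd E {u} \<inter> R) \<ge> 3"
        using card_Un_le[of "nbhd E {u} \<inter> K" "nbhd E {u} \<inter> R"] by simp
      moreover have "card R = 2" "finite R"
        using R(1) v12 by auto
      moreover have "card (nbhd E {u} \<inter> R) \<le> card R"
        using \<open>finite R\<close> by (intro card_mono) auto
      ultimately have "card (nbhd E {u} \<inter> R) = card R" "card (nbhd E {u} \<inter> K) \<noteq> 0"
        using u(2) by linarith+
      then show ?thesis
        using card_subset_eq[OF \<open>finite R\<close>, of "nbhd E {u} \<inter> R"] by auto
    qed
    obtain u zs where xs_eq: "xs = u # zs"
      using ne by (cases xs) auto
    have gx: "gpath E xs" "set xs \<subseteq> K"
      using xs(1) by (auto simp: Ps_def)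
    have fu: "R \<subseteq> nbhd E {u}" "nbhd E {u} \<inter> K \<noteq> {}" "nbhd E {u} \<inter> K \<subseteq> set zs"
      using ends[OF xs(1)] full[of u] False gx(2) by (auto simp: xs_eq)
    then have zs: "zs \<noteq> []"
      by auto
    define u' where "u' = last zs"
    have "rev xs \<in> Ps"
      using xs(1) gpath_rev[of E xs] unfolding Ps_def by simp
    moreover have "hd (rev xs) = u'"
      using zs by (simp add: xs_eq u'_def hd_rev hd_append)
    moreover have "u' \<in> K"
      using gx(2) zs by (auto simp: xs_eq u'_def)
    ultimately have fu': "R \<subseteq> nbhd E {u'}"
      using ends[of "rev xs"] full[of u'] False by simp
    have u'zs: "u' \<in> set zs"
      using zs by (simp add: u'_def)
    have gz: "gpath E zs" "{u, hd zs} \<in> E" "u \<notin> set zs"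
      using gx zs by (auto simp: xs_eq gpath_def pedges_Cons)
    have FZ: "\<exists>z\<in>Z. {w, z} \<in> E" if "w \<in> F" for w
      using that F by (auto simp: nbhd_iff)
    have inF: "v1 \<in> F" "v2 \<in> F" "u \<in> F" "u' \<in> F"
      using R gx(2) KF u'zs by (auto simp: xs_eq)
    obtain z1 z2 z3 z4 where z: "z1 \<in> Z" "z2 \<in> Z" "z3 \<in> Z" "{v1, z1} \<in> E" "{v2, z2} \<in> E" "{u, z3} \<in> E"
      "z4 \<in> Z" "{u', z4} \<in> E"
      using FZ inF by meson
    have uR: "u \<notin> R" "set zs \<inter> R = {}"
      using gx(2) by (auto simp: xs_eq K_def)
    have uv: "{v1, u} \<in> E" "{v2, u} \<in> E" "{u, v2} \<in> E" "{v1, u'} \<in> E" "{v2, u'} \<in> E"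
      using fu(1) fu' R(1) by (simp_all add: nbhd_iff) (simp add: insert_commute)
    have dj: "set zs \<subseteq> W" "v1 \<in> W" "v2 \<in> W" "u \<in> W"
      using gx(2) KF inF by (auto simp: xs_eq)
    have False
    \<comment> \<open>The branch sets are the two roots, the end \<open>u\<close>, the rest of the
      path, and \<open>Z\<close>. The rest contains the other end \<open>u'\<close>, through which
      it is adjacent to both roots; the root edge itself serves as \<open>Q\<close>.\<close>
    proof (rule no_K5[of v1 "[v1, v2]" v2 "[]" u "[]" "set zs" Z u' u' "hd zs" z1 z2 z3 u' z4])
      show "gpath_from_to E v1 [v1, v2] v2"
        using R(2) v12 by (simp add: gpath_from_to_def gpath_def)
      show "gpath_from_to E v1 (v1 # [] @ u # [] @ [v2]) v2"
        using uv v12 uR R(1) by (auto simp: gpath_from_to_def gpath_def)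
      show "set [v1, v2] \<inter> set (v1 # [] @ u # [] @ [v2]) = {v1, v2}"
        by auto
      show "set zs \<inter> (set [v1, v2] \<union> set (v1 # [] @ u # [] @ [v2])) = {}"
        using uR R(1) gz(3) by auto
      show "Z \<inter> (set [v1, v2] \<union> set (v1 # [] @ u # [] @ [v2])) = {}"
        using Z(2) dj by auto
      show "set zs \<inter> Z = {}"
        using Z(2) dj by auto
    qed (use gconnected_gpath[OF gz(1)] Z u'zs zs uv gz(2) z in auto)
    then show ?thesis ..
  qed
qed

end

section \<open>Nonvanishing monomials\<close>

definition unit_exp :: "'v \<Rightarrow> 'v \<Rightarrow>\<^sub>0 nat" where
  "unit_exp v = Poly_Mapping.single v 1"

lemma lookup_unit_exp: "Poly_Mapping.lookup (unit_exp v) u = (if u = v then 1 else 0)"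
  by (simp add: unit_exp_def lookup_single when_def)

text \<open>Subtraction of exponents is truncated, hence the separate test that \<open>m\<close>
  divides \<open>t\<close>.\<close>

lemma lookup_single_mult:
  fixes q :: "('a::cancel_comm_monoid_add) \<Rightarrow>\<^sub>0 ('b::semiring_0)"
  shows "Poly_Mapping.lookup (Poly_Mapping.single m c * q) t =
    (if \<exists>s. t = m + s then c * Poly_Mapping.lookup q (t - m) else 0)"
proof -
  have "Poly_Mapping.lookup (Poly_Mapping.single m c * q) t =
      Sum_any (\<lambda>l. (c when m = l) * Sum_any (\<lambda>s. Poly_Mapping.lookup q s when t = l + s))"
    by (simp add: lookup_mult lookup_single)
  also have "\<dots> = Sum_any (\<lambda>l. c * Sum_any (\<lambda>s. Poly_Mapping.lookup q s when t = m + s) when l = m)"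
    by (intro arg_cong[where f = Sum_any]) (auto simp: when_def fun_eq_iff)
  also have "\<dots> = c * Sum_any (\<lambda>s. Poly_Mapping.lookup q s when t = m + s)"
    by simp
  also have "Sum_any (\<lambda>s. Poly_Mapping.lookup q s when t = m + s) =
      (if \<exists>s. t = m + s then Poly_Mapping.lookup q (t - m) else 0)"
  proof (cases "\<exists>s. t = m + s")
    case True
    then have "t = m + s \<longleftrightarrow> s = t - m" for s
      by auto
    then show ?thesis
      using True by (simp only: Sum_any_when_equal if_True)
  next
    case False
    then have "t \<noteq> m + s" for s
      by blast
    then show ?thesis
      using False by simp
  qed
  also have "c * \<dots> = (if \<exists>s. t = m + s then c * Poly_Mapping.lookup q (t - m) else 0)"
    by simp
  finally show ?thesis .
qed

text \<open>The only other contribution to \<open>t + unit_exp u\<close> takes the second term of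
  the binomial and a monomial \<open>s\<close> as in the hypothesis, whose coefficient is 0.\<close>

lemma lookup_binomial_mult:
  fixes q :: "'v int_mpoly"
  assumes "\<And>s. t + unit_exp u = s + unit_exp v \<Longrightarrow> Poly_Mapping.lookup q s = 0"
  shows "Poly_Mapping.lookup ((Poly_Mapping.single (unit_exp u) a + Poly_Mapping.single (unit_exp v) b) * q)
           (t + unit_exp u) = a * Poly_Mapping.lookup q t"
proof -
  have "Poly_Mapping.lookup q (t + unit_exp u - unit_exp v) = 0" if "t + unit_exp u = unit_exp v + s" for s
    using assms[of s] that by (simp add: add.commute)
  then show ?thesis
    by (auto simp: distrib_right lookup_add lookup_single_mult add.commute[of t])
qed

lemma lookup_binomial_mult_nonzero:
  fixes q :: "'v int_mpoly"
  assumes "Poly_Mapping.lookup ((Poly_Mapping.single (unit_exp u) a + Poly_Mapping.single (unit_exp v) b) * q) t \<noteq> 0"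
  obtains w s where "w \<in> {u, v}" "t = s + unit_exp w" "Poly_Mapping.lookup q s \<noteq> 0"
  using assms that unfolding distrib_right lookup_add lookup_single_mult
  by (fastforce split: if_splits simp: add.commute)

text \<open>Abstracts from signs and from the vertex order. As the condition is symmetric in the two
  ends, an edge may be charged to either of them, meaning that the variable of this end is taken
  from its factor.\<close>

locale edge_forms =
  fixes E :: "'v set set" and f :: "'v set \<Rightarrow> 'v int_mpoly"
  assumes card_edge: "e \<in> E \<Longrightarrow> card e = 2"
    and finite_edges: "finite E"
    and form: "{u, v} \<in> E \<Longrightarrow> u \<noteq> v \<Longrightarrow> \<exists>a b. a \<noteq> 0 \<and> b \<noteq> 0 \<and>
      f {u, v} = Poly_Mapping.single (unit_exp u) a + Poly_Mapping.single (unit_exp v) b"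
begin

definition nz :: "'v set set \<Rightarrow> ('v \<Rightarrow>\<^sub>0 nat) \<Rightarrow> bool" where
  "nz A t \<longleftrightarrow> A \<subseteq> E \<and> Poly_Mapping.lookup (prod f A) t \<noteq> 0"

lemma edge_neq: "{u, v} \<in> E \<Longrightarrow> u \<noteq> v"
  using card_edge[of "{u, v}"] by auto

lemma nz_empty: "nz {} 0"
  by (simp add: nz_def)

lemma nz_finite: "nz A t \<Longrightarrow> finite A"
  using finite_edges finite_subset by (auto simp: nz_def)

lemma nz_insert:
  assumes "nz A t" "{u, v} \<in> E" "{u, v} \<notin> A" "\<And>s. t + unit_exp u = s + unit_exp v \<Longrightarrow> \<not> nz A s"
  shows "nz (insert {u, v} A) (t + unit_exp u)"
proof -
  have "u \<noteq> v"
    using card_edge[OF assms(2)] by auto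
  then obtain a b where ab: "a \<noteq> 0"
    "f {u, v} = Poly_Mapping.single (unit_exp u) a + Poly_Mapping.single (unit_exp v) b"
    using form[OF assms(2)] by blast
  have "Poly_Mapping.lookup (f {u, v} * prod f A) (t + unit_exp u) = a * Poly_Mapping.lookup (prod f A) t"
    unfolding ab(2) using assms(1,4) by (intro lookup_binomial_mult) (auto simp: nz_def)
  then show ?thesis
    using assms(1-3) ab(1) nz_finite[OF assms(1)] by (simp add: nz_def)
qed

text \<open>The exponent of \<open>v\<close> in the new monomial is 0, so the term with
  \<open>v\<close> in the new factor cannot contribute and nothing cancels.\<close>

lemma nz_insert_zero:
  assumes "nz A t" "{u, v} \<in> E" "{u, v} \<notin> A" "Poly_Mapping.lookup t v = 0"
  shows "nz (insert {u, v} A) (t + unit_exp u)"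
proof (rule nz_insert[OF assms(1-3)])
  fix s assume s: "t + unit_exp u = s + unit_exp v"
  have "u \<noteq> v"
    using card_edge[OF assms(2)] by auto
  then have False
    using arg_cong[OF s, of "\<lambda>m. Poly_Mapping.lookup m v"] assms(4) by (simp add: lookup_add lookup_unit_exp)
  then show "\<not> nz A s" ..
qed

lemma nz_insertE:
  assumes "nz (insert e A) t" "e \<notin> A"
  obtains w s where "w \<in> e" "t = s + unit_exp w" "nz A s"
proof -
  have e: "e \<in> E" and fin: "finite A"
    using assms(1) nz_finite[OF assms(1)] by (auto simp: nz_def)
  obtain u v where uv: "e = {u, v}" "u \<noteq> v"
    using card_edge[OF e] by (auto simp: card_2_iff)
  obtain a b where f: "f e = Poly_Mapping.single (unit_exp u) a + Poly_Mapping.single (unit_exp v) b"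
    using form uv e by blast
  have "Poly_Mapping.lookup (f e * prod f A) t \<noteq> 0"
    using assms fin by (simp add: nz_def)
  then show ?thesis
    unfolding f by (rule lookup_binomial_mult_nonzero) (use that assms(1) uv in \<open>auto simp: nz_def\<close>)
qed

text \<open>Cancellation can destroy monomials but not create them. So a monomial that survives
  comes from some choice \<open>h\<close> of an end for each edge of \<open>A\<close>, that is, from
  an orientation.\<close>

lemma nz_UnE:
  assumes "nz (A \<union> B) t" "A \<inter> B = {}" "finite A"
  obtains h s where "\<And>e. e \<in> A \<Longrightarrow> h e \<in> e" "t = s + (\<Sum>e\<in>A. unit_exp (h e))" "nz B s"
  using assms(3,1,2)
proof (induction A arbitrary: t thesis rule: finite_induct)
  case empty
  then show ?case by simp
next
  case (insert e A)
  have "nz (insert e (A \<union> B)) t" "e \<notin> A \<union> B"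
    using insert by auto
  then obtain w s where w: "w \<in> e" "t = s + unit_exp w" "nz (A \<union> B) s"
    using nz_insertE by blast
  obtain h s' where h: "\<And>e. e \<in> A \<Longrightarrow> h e \<in> e" "s = s' + (\<Sum>e\<in>A. unit_exp (h e))" "nz B s'"
    using insert.IH[of s] w(3) insert.prems by blast
  have "(\<Sum>x\<in>A. unit_exp ((h(e := w)) x)) = (\<Sum>e\<in>A. unit_exp (h e))"
    using insert.hyps by (intro sum.cong) auto
  then show ?case
    using h w insert.hyps by (intro insert.prems(1)[of "h(e := w)" s']) (auto simp: algebra_simps)
qed

lemma nz_lookup_zero:
  assumes "nz A t" "v \<notin> \<Union> A"
  shows "Poly_Mapping.lookup t v = 0"
proof -
  have "nz {} s \<Longrightarrow> s = 0" for s
    by (simp add: nz_def lookup_one when_def split: if_splits)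
  then obtain h where h: "\<And>e. e \<in> A \<Longrightarrow> h e \<in> e" "t = (\<Sum>e\<in>A. unit_exp (h e))"
    using nz_UnE[of A "{}" t] nz_finite[OF assms(1)] assms(1) by (metis add_0 inf_bot_right sup_bot_right)
  have "h e \<noteq> v" if "e \<in> A" for e
    using h(1)[OF that] assms(2) that by blast
  then show ?thesis
    unfolding h(2) lookup_sum lookup_unit_exp by (intro sum.neutral) auto
qed

lemma nz_degree:
  assumes "nz A t" "finite W" "\<Union> A \<subseteq> W"
  shows "(\<Sum>v\<in>W. Poly_Mapping.lookup t v) = card A"
proof -
  have "nz {} s \<Longrightarrow> s = 0" for s
    by (simp add: nz_def lookup_one when_def split: if_splits)
  then obtain h where h: "\<And>e. e \<in> A \<Longrightarrow> h e \<in> e" "t = (\<Sum>e\<in>A. unit_exp (h e))"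
    using nz_UnE[of A "{}" t] nz_finite[OF assms(1)] assms(1) by (metis add_0 inf_bot_right sup_bot_right)
  have "(\<Sum>v\<in>W. Poly_Mapping.lookup t v) = (\<Sum>e\<in>A. \<Sum>v\<in>W. if v = h e then 1 else 0)"
    unfolding h(2) lookup_sum lookup_unit_exp by (rule sum.swap)
  also have "\<dots> = (\<Sum>e\<in>A. 1)"
    using h(1) assms(2,3) by (intro sum.cong) (auto simp: sum.delta)
  finally show ?thesis by simp
qed

text \<open>The factorisation of \<open>t1 + t2\<close> is unique. In another one,
  \<open>q1 + q2\<close>, the part \<open>q2\<close> agrees with \<open>t2\<close> off the shared
  vertices and dominates it on them, where \<open>t2\<close> is 0. Both have degree
  \<open>card A2\<close>, so they are equal, and the coefficient is a product of two nonzero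
  integers.\<close>

lemma nz_Un:
  assumes nz: "nz A1 t1" "nz A2 t2" and disj: "A1 \<inter> A2 = {}"
    and zero: "\<And>v. v \<in> \<Union> A1 \<inter> \<Union> A2 \<Longrightarrow> Poly_Mapping.lookup t2 v = 0"
  shows "nz (A1 \<union> A2) (t1 + t2)"
proof -
  let ?S = "\<Union> A1 \<inter> \<Union> A2"
  have fin: "finite A1" "finite A2"
    using nz nz_finite by auto
  have "finite e" if "e \<in> A2" for e
    using that nz(2) card_edge[of e] card_ge_0_finite[of e] by (auto simp: nz_def)
  then have finW: "finite (\<Union> A2)"
    using fin by blast
  have uniq: "q1 = t1 \<and> q2 = t2" if q: "nz A1 q1" "nz A2 q2" and eq: "t1 + t2 = q1 + q2" for q1 q2
  proof -
    have ev: "Poly_Mapping.lookup t1 v + Poly_Mapping.lookup t2 v =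
        Poly_Mapping.lookup q1 v + Poly_Mapping.lookup q2 v" for v
      using arg_cong[OF eq, of "\<lambda>m. Poly_Mapping.lookup m v"] by (simp add: lookup_add)
    have off: "Poly_Mapping.lookup q2 v = Poly_Mapping.lookup t2 v" if "v \<notin> ?S" for v
    proof (cases "v \<in> \<Union> A2")
      case True
      then have "v \<notin> \<Union> A1" using that by blast
      then show ?thesis
        using ev[of v] nz_lookup_zero[OF nz(1)] nz_lookup_zero[OF q(1)] by simp
    next
      case False
      then show ?thesis
        using nz_lookup_zero[OF nz(2)] nz_lookup_zero[OF q(2)] by simp
    qed
    have "(\<Sum>v\<in>\<Union> A2. Poly_Mapping.lookup q2 v) = (\<Sum>v\<in>\<Union> A2. Poly_Mapping.lookup t2 v)"
      using nz_degree[OF q(2) finW] nz_degree[OF nz(2) finW] by simp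
    moreover have "Poly_Mapping.lookup t2 v \<le> Poly_Mapping.lookup q2 v" for v
      using off[of v] zero[of v] by (cases "v \<in> ?S") auto
    ultimately have "Poly_Mapping.lookup q2 v = Poly_Mapping.lookup t2 v" if "v \<in> \<Union> A2" for v
      using sum_mono_inv[of "Poly_Mapping.lookup t2" "\<Union> A2" "Poly_Mapping.lookup q2" v] finW that by simp
    then have "Poly_Mapping.lookup q2 v = Poly_Mapping.lookup t2 v" for v
      using off[of v] by blast
    then have "q2 = t2"
      by (intro poly_mapping_eqI)
    then show ?thesis
      using eq by simp
  qed
  let ?f1 = "prod f A1" and ?f2 = "prod f A2"
  have "Poly_Mapping.lookup ?f1 l * Sum_any (\<lambda>q. Poly_Mapping.lookup ?f2 q when t1 + t2 = l + q) =
      (Poly_Mapping.lookup ?f1 t1 * Poly_Mapping.lookup ?f2 t2 when l = t1)" for l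
  proof (cases "l = t1")
    case True
    then show ?thesis by (simp add: eq_commute[of t2])
  next
    case False
    have zero: "(Poly_Mapping.lookup ?f2 q when t1 + t2 = l + q) = 0" if "Poly_Mapping.lookup ?f1 l \<noteq> 0" for q
      using uniq[of l q] False nz that by (auto simp: nz_def when_def)
    show ?thesis
    proof (cases "Poly_Mapping.lookup ?f1 l = 0")
      case False
      show ?thesis
        using \<open>l \<noteq> t1\<close> by (simp only: zero[OF False]) simp
    qed (use False in simp)
  qed
  then have "Poly_Mapping.lookup (?f1 * ?f2) (t1 + t2) = Poly_Mapping.lookup ?f1 t1 * Poly_Mapping.lookup ?f2 t2"
    by (simp add: lookup_mult)
  then show ?thesis
    using nz disj fin by (simp add: nz_def prod.union_disjoint)
qed

section \<open>Adding all edges at one vertex\<close>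

definition star :: "'v \<Rightarrow> 'v set \<Rightarrow> 'v set set" where
  "star v U = (\<lambda>u. {v, u}) ` U"

text \<open>Each edge is charged to its end in \<open>U\<close>; the exponent of \<open>v\<close>
  stays 0 throughout, so \<open>nz_insert_zero\<close> applies every time.\<close>

lemma nz_star_out:
  assumes "finite U" "nz B t" "star v U \<subseteq> E" "star v U \<inter> B = {}" "Poly_Mapping.lookup t v = 0"
  shows "nz (B \<union> star v U) (t + (\<Sum>u\<in>U. unit_exp u))"
  using assms
proof (induction U rule: finite_induct)
  case empty
  then show ?case by (simp add: star_def)
next
  case (insert u U)
  have uv: "{v, u} \<in> E"
    using insert.prems by (simp add: star_def)
  have v: "v \<notin> U" "v \<noteq> u"
    using insert.prems(2) edge_neq by (auto simp: star_def)
  have "nz (insert {u, v} (B \<union> star v U)) (t + (\<Sum>u\<in>U. unit_exp u) + unit_exp u)"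
  proof (rule nz_insert_zero)
    show "nz (B \<union> star v U) (t + (\<Sum>u\<in>U. unit_exp u))"
      using insert by (auto simp: star_def)
    show "{u, v} \<in> E"
      using uv by (simp add: insert_commute)
    show "{u, v} \<notin> B \<union> star v U"
      using insert.prems insert.hyps by (auto simp: star_def doubleton_eq_iff insert_commute)
    show "Poly_Mapping.lookup (t + (\<Sum>u\<in>U. unit_exp u)) v = 0"
      using insert.prems v insert.hyps by (auto simp: lookup_add lookup_sum lookup_unit_exp)
  qed
  moreover have "insert {u, v} (B \<union> star v U) = B \<union> star v (insert u U)"
    by (auto simp: star_def insert_commute)
  ultimately show ?case
    using insert.hyps by (simp add: algebra_simps)
qed

text \<open>Here each edge is charged to \<open>v\<close>, and the exponents on \<open>U\<close>
  stay 0.\<close>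

lemma nz_star_in:
  assumes "finite U" "nz B t" "star v U \<subseteq> E" "star v U \<inter> B = {}" "\<And>u. u \<in> U \<Longrightarrow> Poly_Mapping.lookup t u = 0"
  shows "nz (B \<union> star v U) (t + (\<Sum>u\<in>U. unit_exp v))"
  using assms
proof (induction U rule: finite_induct)
  case empty
  then show ?case by (simp add: star_def)
next
  case (insert u U)
  have uv: "{v, u} \<in> E"
    using insert.prems by (simp add: star_def)
  have v: "v \<notin> U" "v \<noteq> u"
    using insert.prems(2) edge_neq by (auto simp: star_def)
  have "nz (insert {v, u} (B \<union> star v U)) (t + (\<Sum>u\<in>U. unit_exp v) + unit_exp v)"
  proof (rule nz_insert_zero)
    show "nz (B \<union> star v U) (t + (\<Sum>u\<in>U. unit_exp v))"
      using insert by (auto simp: star_def)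
    show "{v, u} \<in> E"
      using uv .
    show "{v, u} \<notin> B \<union> star v U"
      using insert.prems insert.hyps by (auto simp: star_def doubleton_eq_iff insert_commute)
    show "Poly_Mapping.lookup (t + (\<Sum>u\<in>U. unit_exp v)) u = 0"
      using insert.prems v insert.hyps by (auto simp: lookup_add lookup_sum lookup_unit_exp)
  qed
  moreover have "insert {v, u} (B \<union> star v U) = B \<union> star v (insert u U)"
    by (auto simp: star_def)
  ultimately show ?case
    using insert.hyps by (simp add: algebra_simps)
qed

text \<open>Charging the edge \<open>{v, w}\<close> to \<open>v\<close> competes with charging it to
  \<open>w\<close>. In a competing choice the exponent 1 of \<open>v\<close> comes from exactly one
  edge \<open>{v, u}\<close> with \<open>u\<close> in \<open>U\<close>, so the monomial of
  \<open>B\<close> has one unit moved from \<open>w\<close> to \<open>u\<close>. The hypothesis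
  \<open>no\<close> excludes these monomials.\<close>

lemma nz_star_swap:
  assumes "finite U" "nz B t" "star v U \<subseteq> E" "{v, w} \<in> E" "w \<notin> U" "v \<notin> \<Union> B"
    and no: "\<And>u s. u \<in> U \<Longrightarrow> t + unit_exp u = s + unit_exp w \<Longrightarrow> \<not> nz B s"
  shows "nz (insert {v, w} (B \<union> star v U)) (t + (\<Sum>u\<in>U. unit_exp u) + unit_exp v)"
proof (rule nz_insert)
  have tv: "Poly_Mapping.lookup t v = 0"
    using nz_lookup_zero assms(2,6) by blast
  have dis: "star v U \<inter> B = {}"
    using assms(6) by (auto simp: star_def)
  have v: "v \<notin> U" "v \<noteq> w"
    using assms(3,4) edge_neq by (auto simp: star_def)
  show "nz (B \<union> star v U) (t + (\<Sum>u\<in>U. unit_exp u))"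
    using assms(1-3) dis tv by (rule nz_star_out)
  show "{v, w} \<in> E" by fact
  show "{v, w} \<notin> B \<union> star v U"
    using assms(5,6) by (auto simp: star_def doubleton_eq_iff)
  fix s assume s: "t + (\<Sum>u\<in>U. unit_exp u) + unit_exp v = s + unit_exp w"
  show "\<not> nz (B \<union> star v U) s"
  proof
    assume "nz (B \<union> star v U) s"
    then obtain h s' where h: "\<And>e. e \<in> star v U \<Longrightarrow> h e \<in> e"
      "s = s' + (\<Sum>e\<in>star v U. unit_exp (h e))" "nz B s'"
      using nz_UnE[of "star v U" B s] dis assms(1) by (auto simp: Un_commute star_def)
    define k where "k u = h {v, u}" for u
    have inj: "inj_on (\<lambda>u. {v, u}) U"
      using v(1) by (auto simp: inj_on_def doubleton_eq_iff)
    have k: "k u = v \<or> k u = u" if "u \<in> U" for u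
      using h(1)[of "{v, u}"] that by (auto simp: k_def star_def)
    have sk: "s = s' + (\<Sum>u\<in>U. unit_exp (k u))"
      using h(2) inj by (simp add: star_def sum.reindex k_def o_def)
    have s'v: "Poly_Mapping.lookup s' v = 0"
      using nz_lookup_zero h(3) assms(6) by blast
    \<comment> \<open>Comparing exponents at \<open>v\<close> counts the star edges that the
      competing choice charges to \<open>v\<close>.\<close>
    have "1 = Poly_Mapping.lookup (t + (\<Sum>u\<in>U. unit_exp u) + unit_exp v) v"
      using tv v(1) assms(1) by (auto simp: lookup_add lookup_sum lookup_unit_exp)
    also have "\<dots> = (\<Sum>u\<in>U. if k u = v then 1 else 0)"
      unfolding s sk using s'v v by (simp add: lookup_add lookup_sum lookup_unit_exp eq_commute[of v])
    also have "\<dots> = card {u \<in> U. k u = v}"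
      using assms(1) by (simp add: sum.If_cases Int_def)
    finally obtain u where u: "{u \<in> U. k u = v} = {u}"
      by (metis card_1_singletonE)
    have "(\<Sum>u\<in>U. unit_exp (k u)) = unit_exp v + (\<Sum>x\<in>U - {u}. unit_exp x)"
    proof -
      have "u \<in> U" "k u = v"
        using u by auto
      moreover have "(\<Sum>x\<in>U - {u}. unit_exp (k x)) = (\<Sum>x\<in>U - {u}. unit_exp x)"
      proof (intro sum.cong refl)
        fix x assume "x \<in> U - {u}"
        then have "k x = x"
          using u k[of x] by blast
        then show "unit_exp (k x) = unit_exp x"
          by simp
      qed
      ultimately show ?thesis
        using assms(1) by (simp add: sum.remove[of U u])
    qed
    moreover have "(\<Sum>x\<in>U. unit_exp x) = unit_exp u + (\<Sum>x\<in>U - {u}. unit_exp x)"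
      using u assms(1) by (intro sum.remove) auto
    ultimately have "(t + unit_exp u) + ((\<Sum>x\<in>U - {u}. unit_exp x) + unit_exp v) =
        (s' + unit_exp w) + ((\<Sum>x\<in>U - {u}. unit_exp x) + unit_exp v)"
      using s unfolding sk by (simp add: algebra_simps)
    then have "t + unit_exp u = s' + unit_exp w"
      by simp
    then show False
      using no[of u s'] u h(3) by auto
  qed
qed

end

section \<open>Extending good monomials\<close>

context edge_forms
begin

definition induced :: "'v set \<Rightarrow> 'v set set" where
  "induced W = {e \<in> E. e \<subseteq> W}"

text \<open>\<open>R\<close> is the set of roots and, if it has two elements, also the omitted edge.
  A set of another size is no edge, and then nothing is omitted.\<close>

definition good :: "'v set \<Rightarrow> 'v set \<Rightarrow> 'v set \<Rightarrow> ('v \<Rightarrow>\<^sub>0 nat) \<Rightarrow> bool" where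
  "good W F R t \<longleftrightarrow> nz (induced W - {R}) t \<and>
     (\<forall>v\<in>R. Poly_Mapping.lookup t v = 0) \<and>
     (\<forall>v\<in>F. Poly_Mapping.lookup t v \<le> 2) \<and>
     (\<forall>v\<in>W. Poly_Mapping.lookup t v \<le> 4)"

lemma goodD:
  assumes "good W F R t"
  shows "nz (induced W - {R}) t" "v \<in> R \<Longrightarrow> Poly_Mapping.lookup t v = 0"
    "v \<in> F \<Longrightarrow> Poly_Mapping.lookup t v \<le> 2" "v \<in> W \<Longrightarrow> Poly_Mapping.lookup t v \<le> 4"
  using assms by (auto simp: good_def)

lemma goodI:
  assumes "nz (induced W - {R}) t" "\<And>v. v \<in> R \<Longrightarrow> Poly_Mapping.lookup t v = 0"
    "\<And>v. v \<in> F \<Longrightarrow> Poly_Mapping.lookup t v \<le> 2" "\<And>v. v \<in> W \<Longrightarrow> Poly_Mapping.lookup t v \<le> 4"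
  shows "good W F R t"
  using assms by (auto simp: good_def)

lemma induced_notin_edges: "card R \<noteq> 2 \<Longrightarrow> induced W - {R} = induced W"
  using card_edge by (auto simp: induced_def)

lemma induced_remove:
  assumes "v \<in> W"
  shows "induced W = induced (W - {v}) \<union> star v (nbhd E {v} \<inter> W)"
proof (intro equalityI subsetI)
  fix e assume e: "e \<in> induced W"
  then have "card e = 2"
    using card_edge by (simp add: induced_def)
  then obtain x y where xy: "e = {x, y}" "x \<noteq> y"
    by (auto simp: card_2_iff)
  then show "e \<in> induced (W - {v}) \<union> star v (nbhd E {v} \<inter> W)"
    using e by (auto simp: induced_def star_def nbhd_def insert_commute doubleton_eq_iff image_iff)
next
  fix e assume "e \<in> induced (W - {v}) \<union> star v (nbhd E {v} \<inter> W)"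
  then show "e \<in> induced W"
    using assms by (auto simp: induced_def star_def nbhd_def)
qed

lemma star_subset: "U \<subseteq> nbhd E {v} \<Longrightarrow> star v U \<subseteq> E"
  by (auto simp: star_def nbhd_def)

lemma nbhd_irrefl: "v \<notin> nbhd E {v}"
  using card_edge[of "{v}"] by (auto simp: nbhd_def)

lemma finite_vertices: "finite (\<Union> E)"
proof -
  have "finite e" if "e \<in> E" for e
    using card_edge[OF that] card_ge_0_finite[of e] by simp
  then show ?thesis
    using finite_edges by blast
qed

lemma finite_nbhd: "finite (nbhd E {v})"
  using finite_vertices by (rule finite_subset[rotated]) (auto simp: nbhd_def)

lemma lookup_sum_unit_exp: "finite U \<Longrightarrow> Poly_Mapping.lookup (\<Sum>u\<in>U. unit_exp u) v = (if v \<in> U then 1 else 0)"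
  by (simp add: lookup_sum lookup_unit_exp)

lemma lookup_sum_unit_exp_const: "Poly_Mapping.lookup (\<Sum>u\<in>U. unit_exp w) v = (if v = w then card U else 0)"
  by (simp add: lookup_sum lookup_unit_exp)

text \<open>All edges at \<open>v\<close> are charged to the neighbours. These have exponent at most
  2 before, being in \<open>F'\<close>, and may rise to 3 since none of them is in
  \<open>F\<close>.\<close>

lemma good_remove_to_nbhd:
  assumes v: "v \<in> W" and t: "good (W - {v}) F' {} t"
    and F': "nbhd E {v} \<inter> W \<subseteq> F'" "F - {v} \<subseteq> F'" and disj: "nbhd E {v} \<inter> F = {}"
  shows "good W F {v} (t + (\<Sum>u\<in>nbhd E {v} \<inter> W. unit_exp u))"
proof -
  let ?U = "nbhd E {v} \<inter> W"
  have fin: "finite ?U"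
    using finite_nbhd by blast
  have nz: "nz (induced (W - {v})) t"
    using goodD(1)[OF t] induced_notin_edges[of "{}"] by simp
  have tv: "Poly_Mapping.lookup t v = 0"
    by (rule nz_lookup_zero[OF nz]) (auto simp: induced_def)
  have val: "Poly_Mapping.lookup (t + (\<Sum>u\<in>?U. unit_exp u)) x =
      Poly_Mapping.lookup t x + (if x \<in> ?U then 1 else 0)" for x
    using fin by (simp only: lookup_add lookup_sum_unit_exp)
  have U2: "Poly_Mapping.lookup t x \<le> 2" if "x \<in> ?U" for x
    using goodD(3)[OF t, of x] F'(1) that by blast
  have v0: "Poly_Mapping.lookup (t + (\<Sum>u\<in>?U. unit_exp u)) v = 0"
    using tv nbhd_irrefl[of v] by (simp add: val)
  show ?thesis
  proof (rule goodI)
    have "nz (induced (W - {v}) \<union> star v ?U) (t + (\<Sum>u\<in>?U. unit_exp u))"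
      by (rule nz_star_out[OF fin nz _ _ tv]) (auto simp: star_def nbhd_def induced_def)
    then show "nz (induced W - {{v}}) (t + (\<Sum>u\<in>?U. unit_exp u))"
      using induced_remove[OF v] induced_notin_edges[of "{v}" W] by simp
    fix x
    show "x \<in> {v} \<Longrightarrow> Poly_Mapping.lookup (t + (\<Sum>u\<in>?U. unit_exp u)) x = 0"
      using v0 by simp
    show "Poly_Mapping.lookup (t + (\<Sum>u\<in>?U. unit_exp u)) x \<le> 2" if "x \<in> F"
    proof (cases "x = v")
      case False
      then show ?thesis
        using goodD(3)[OF t, of x] F'(2) that disj by (auto simp: val)
    qed (simp add: v0)
    show "Poly_Mapping.lookup (t + (\<Sum>u\<in>?U. unit_exp u)) x \<le> 4" if "x \<in> W"
    proof (cases "x = v")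
      case False
      then show ?thesis
        using goodD(4)[OF t, of x] U2[of x] that by (auto simp: val)
    qed (simp add: v0)
  qed
qed

text \<open>The omitted edge is put back and charged to \<open>b\<close>; nothing cancels because
  the other root has exponent 0.\<close>

lemma good_unroot:
  assumes t: "good W F {a, b} t" and ab: "{a, b} \<in> E" "a \<in> W" "b \<in> W"
  shows "good W F {a} (t + unit_exp b)"
proof -
  have ne: "a \<noteq> b"
    using edge_neq[OF ab(1)] .
  have "nz (insert {b, a} (induced W - {{a, b}})) (t + unit_exp b)"
    using ab goodD(1,2)[OF t] by (intro nz_insert_zero) (auto simp: insert_commute)
  moreover have "insert {b, a} (induced W - {{a, b}}) = induced W"
    using ab by (auto simp: induced_def insert_commute)
  moreover have "Poly_Mapping.lookup t a = 0" "Poly_Mapping.lookup t b = 0"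
    using goodD(2)[OF t] by auto
  ultimately show ?thesis
    using t ne induced_notin_edges[of "{a}" W] by (auto simp: good_def lookup_add lookup_unit_exp)
qed

lemma good_forget_root: "good W F {a} t \<Longrightarrow> good W F {} t"
  using induced_notin_edges[of "{a}" W] induced_notin_edges[of "{}" W] by (simp add: good_def)

text \<open>Settles the case in which the roots are the only outer vertices. A common neighbour of
  both roots is charged twice and rises from at most 2 to at most 4.\<close>

lemma good_remove_both_roots:
  assumes t: "good (W - {a, b}) F' {} t" and ab: "{a, b} \<in> E" "a \<in> W" "b \<in> W"
    and F': "nbhd E {a} \<inter> W - {b} \<subseteq> F'" "nbhd E {b} \<inter> W - {a} \<subseteq> F'"
  obtains t' where "good W {a, b} {a, b} t'"
proof -
  let ?A = "nbhd E {a} \<inter> W - {b}" and ?B = "nbhd E {b} \<inter> W - {a}"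
  let ?I = "induced (W - {a, b})"
  define t' where "t' = t + (\<Sum>u\<in>?B. unit_exp u) + (\<Sum>u\<in>?A. unit_exp u)"
  have ne: "a \<noteq> b"
    using edge_neq[OF ab(1)] .
  have fin: "finite ?A" "finite ?B"
    using finite_nbhd by auto
  have nz0: "nz ?I t"
    using goodD(1)[OF t] induced_notin_edges[of "{}"] by simp
  have tab: "Poly_Mapping.lookup t a = 0" "Poly_Mapping.lookup t b = 0"
    by (rule nz_lookup_zero[OF nz0]; auto simp: induced_def)+
  have nz1: "nz (?I \<union> star b ?B) (t + (\<Sum>u\<in>?B. unit_exp u))"
    by (rule nz_star_out[OF fin(2) nz0 _ _ tab(2)]) (auto simp: star_def nbhd_def induced_def)
  have nz2: "nz (?I \<union> star b ?B \<union> star a ?A) t'"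
    unfolding t'_def
  proof (rule nz_star_out[OF fin(1) nz1])
    show "star a ?A \<subseteq> E"
      by (rule star_subset) auto
    show "star a ?A \<inter> (?I \<union> star b ?B) = {}"
      using ne by (auto simp: star_def induced_def doubleton_eq_iff)
    show "Poly_Mapping.lookup (t + (\<Sum>u\<in>?B. unit_exp u)) a = 0"
      using tab fin by (simp add: lookup_add lookup_sum_unit_exp)
  qed
  have ind: "?I \<union> star b ?B \<union> star a ?A = induced W - {{a, b}}"
  proof -
    have "nbhd E {b} \<inter> (W - {a}) = ?B"
      by auto
    then have "induced (W - {a}) = ?I \<union> star b ?B"
      using induced_remove[of b "W - {a}"] ne ab by (simp add: Diff_insert2[symmetric] insert_commute)
    moreover have "induced W = induced (W - {a}) \<union> star a (nbhd E {a} \<inter> W)"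
      by (rule induced_remove[OF ab(2)])
    moreover have "star a (nbhd E {a} \<inter> W) = insert {a, b} (star a ?A)"
      using ab by (auto simp: star_def nbhd_def)
    moreover have "{a, b} \<notin> induced (W - {a})" "{a, b} \<notin> star a ?A"
      by (auto simp: induced_def star_def doubleton_eq_iff)
    ultimately show ?thesis
      by blast
  qed
  have val: "Poly_Mapping.lookup t' x = Poly_Mapping.lookup t x + (if x \<in> ?B then 1 else 0) + (if x \<in> ?A then 1 else 0)" for x
    using fin by (simp add: t'_def lookup_add lookup_sum_unit_exp)
  have t'0: "Poly_Mapping.lookup t' a = 0" "Poly_Mapping.lookup t' b = 0"
    using val tab nbhd_irrefl[of a] nbhd_irrefl[of b] by auto
  have t'4: "Poly_Mapping.lookup t' x \<le> 4" if x: "x \<in> W" for x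
  proof (cases "x \<in> ?A \<union> ?B")
    case True
    then have "Poly_Mapping.lookup t x \<le> 2"
      using F' goodD(3)[OF t] by blast
    then show ?thesis by (simp add: val)
  next
    case False
    then have "Poly_Mapping.lookup t' x = Poly_Mapping.lookup t x"
      unfolding val by (simp only: Un_iff if_False de_Morgan_disj add_0_right)
    moreover have "Poly_Mapping.lookup t x \<le> 4"
    proof (cases "x = a \<or> x = b")
      case False
      then show ?thesis
        using goodD(4)[OF t, of x] x by blast
    qed (use tab in auto)
    ultimately show ?thesis
      by simp
  qed
  have "good W {a, b} {a, b} t'"
    using nz2[unfolded ind] t'0 t'4 by (intro goodI) auto
  then show ?thesis
    by (rule that)
qed

text \<open>The separator carries the roots of the second piece, so \<open>t2\<close> is 0 there and
  the exponents of \<open>t1\<close> are kept. An edge spanned by the separator is counted in the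
  first piece only, being the omitted root edge of the second.\<close>

lemma good_glue:
  assumes t1: "good W1 F1 R t1" and t2: "good W2 F2 (W1 \<inter> W2) t2"
    and sep: "induced (W1 \<union> W2) = induced W1 \<union> induced W2" and S: "card (W1 \<inter> W2) \<le> 2" "finite W1"
    and R: "R \<inter> W2 = {}" "R \<noteq> {}" and F: "F \<inter> W1 \<subseteq> F1" "F \<inter> W2 \<subseteq> F2" "F \<subseteq> W1 \<union> W2" "R \<subseteq> W1"
  shows "good (W1 \<union> W2) F R (t1 + t2)"
proof -
  let ?S = "W1 \<inter> W2"
  let ?A1 = "induced W1 - {R}" and ?A2 = "induced W2 - {?S}"
  have inS: "e = ?S" if "e \<in> induced W1" "e \<in> induced W2" for e
    using that S card_edge[of e] by (intro card_seteq) (auto simp: induced_def)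
  have "nz (?A1 \<union> ?A2) (t1 + t2)"
  proof (rule nz_Un[OF goodD(1)[OF t1] goodD(1)[OF t2]])
    show "?A1 \<inter> ?A2 = {}"
      using inS by blast
    fix v assume "v \<in> \<Union> ?A1 \<inter> \<Union> ?A2"
    then have "v \<in> ?S"
      by (auto simp: induced_def)
    then show "Poly_Mapping.lookup t2 v = 0"
      by (rule goodD(2)[OF t2])
  qed
  moreover have "?A1 \<union> ?A2 = induced (W1 \<union> W2) - {R}"
  proof -
    have "R \<notin> induced W2"
      using R by (auto simp: induced_def)
    moreover have "?S \<in> induced W1" if "?S \<in> induced W2"
      using that by (auto simp: induced_def)
    moreover have "?S \<noteq> R" if "?S \<in> induced W2"
      using that \<open>R \<notin> induced W2\<close> by metis
    ultimately show ?thesis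
      unfolding sep by blast
  qed
  moreover have z1: "Poly_Mapping.lookup t1 v = 0" if "v \<notin> W1" for v
    using that by (intro nz_lookup_zero[OF goodD(1)[OF t1]]) (auto simp: induced_def)
  moreover have z2: "Poly_Mapping.lookup t2 v = 0" if "v \<notin> W2 - W1" for v
  proof (cases "v \<in> W2")
    case False
    then show ?thesis
      by (intro nz_lookup_zero[OF goodD(1)[OF t2]]) (auto simp: induced_def)
  qed (use that goodD(2)[OF t2] in auto)
  moreover have "Poly_Mapping.lookup (t1 + t2) v = (if v \<in> W1 then Poly_Mapping.lookup t1 v else Poly_Mapping.lookup t2 v)" for v
    using z1[of v] z2[of v] by (simp add: lookup_add)
  ultimately show ?thesis
    using goodD(2-4)[OF t1] goodD(3,4)[OF t2] R F unfolding good_def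
    by (smt (verit, ccfv_threshold) IntI Un_iff subset_iff)
qed

text \<open>Neighbours of \<open>v\<close> outside \<open>F\<close> become outer vertices, so their
  exponents are at most 2 and they can absorb their edge to \<open>v\<close>. Edges to roots must go
  to \<open>v\<close>. Critical is the edge to a further neighbour \<open>w\<close> in
  \<open>F\<close>: \<open>w\<close> may already have exponent 2, while charging \<open>v\<close>
  may cause cancellation.\<close>

lemma good_remove:
  assumes v: "v \<in> F" "v \<notin> R" and R: "R \<subseteq> F" "F \<subseteq> W"
    and t: "good (W - {v}) F' R t" and F': "nbhd E {v} \<inter> W \<subseteq> F'" "F - {v} \<subseteq> F'"
    and card: "card (nbhd E {v} \<inter> F) \<le> 2" "card (nbhd E {v} \<inter> F - R) \<le> 1"
  shows "\<exists>t'. good W F R t'"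
proof -
  let ?N = "nbhd E {v} \<inter> W" and ?U = "nbhd E {v} \<inter> W - F" and ?Q = "nbhd E {v} \<inter> R"
  let ?I = "induced (W - {v}) - {R}"
  have vW: "v \<in> W"
    using v R by blast
  have fin: "finite ?U" "finite ?Q" "finite ?N"
    using finite_nbhd by auto
  have vI: "v \<notin> \<Union> ?I"
    by (auto simp: induced_def)
  have star_un: "star v (A \<union> B) = star v A \<union> star v B" for A B
    by (auto simp: star_def)
  have ind: "induced W - {R} = ?I \<union> star v ?N"
    using induced_remove[OF vW] v(2) by (auto simp: star_def)
  have irr: "v \<notin> nbhd E {v}"
    by (rule nbhd_irrefl)
  have starI: "star v A \<inter> ?I = {}" for A
    using vI unfolding star_def by blast
  have disjQ: "star v ?Q \<inter> (?I \<union> star v A) = {}" if "A \<inter> R = {}" for A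
  proof -
    have "{v, q} \<noteq> {v, a}" if "q \<in> R" "a \<in> A" for q a
      using that \<open>A \<inter> R = {}\<close> by (metis doubleton_eq_iff disjoint_iff)
    then have "star v ?Q \<inter> star v A = {}"
      unfolding star_def by blast
    then show ?thesis
      unfolding Int_Un_distrib starI by simp
  qed
  have tv: "Poly_Mapping.lookup s v = 0" if "nz ?I s" for s
    using nz_lookup_zero[OF that vI] .
  have out: "nz (?I \<union> star v A) (s + (\<Sum>u\<in>A. unit_exp u))" if "nz ?I s" "A \<subseteq> ?N" for s A
  proof (rule nz_star_out[OF _ that(1) _ _ tv[OF that(1)]])
    show "finite A"
      using finite_subset[OF that(2) fin(3)] .
    show "star v A \<subseteq> E"
      using that(2) by (intro star_subset) auto
    show "star v A \<inter> ?I = {}"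
      by (rule starI)
  qed
  text \<open>The edges from \<open>v\<close> to its neighbours in \<open>R\<close> are all charged to \<open>v\<close>.\<close>
  have finish: "\<exists>t'. good W F R t'"
    if s: "nz (?I \<union> star v A) s" and A: "A \<union> ?Q = ?N" "A \<inter> R = {}"
      and s0: "\<And>x. x \<in> R \<Longrightarrow> Poly_Mapping.lookup s x = 0"
      and s2: "\<And>x. x \<in> F - {v} \<Longrightarrow> Poly_Mapping.lookup s x \<le> 2"
      and s4: "\<And>x. x \<in> W - {v} \<Longrightarrow> Poly_Mapping.lookup s x \<le> 4"
      and sv: "Poly_Mapping.lookup s v + card ?Q \<le> 2" for A s
  proof -
    have "nz (?I \<union> star v A \<union> star v ?Q) (s + (\<Sum>u\<in>?Q. unit_exp v))"
      using s0 A by (intro nz_star_in[OF fin(2) s star_subset disjQ]) auto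
    then have "nz (induced W - {R}) (s + (\<Sum>u\<in>?Q. unit_exp v))"
      by (simp add: ind A(1)[symmetric] star_un Un_assoc)
    moreover have "Poly_Mapping.lookup (s + (\<Sum>u\<in>?Q. unit_exp v)) x =
        Poly_Mapping.lookup s x + (if x = v then card ?Q else 0)" for x
      by (simp add: lookup_add lookup_sum_unit_exp_const)
    ultimately have "good W F R (s + (\<Sum>u\<in>?Q. unit_exp v))"
      using s0 s2 s4 sv v by (auto simp: good_def)
    then show ?thesis ..
  qed
  have QF: "?Q \<subseteq> nbhd E {v} \<inter> F" "finite (nbhd E {v} \<inter> F)"
    using R finite_nbhd by auto
  show ?thesis
  proof (cases "nbhd E {v} \<inter> F - R = {}")
    case True
    have U: "?U \<union> ?Q = ?N" "?U \<inter> R = {}"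
      using True R by auto
    show ?thesis
    proof (rule finish[OF out[OF goodD(1)[OF t]] U])
      fix x
      show "x \<in> R \<Longrightarrow> Poly_Mapping.lookup (t + (\<Sum>u\<in>?U. unit_exp u)) x = 0"
        using goodD(2)[OF t, of x] R fin by (auto simp: lookup_add lookup_sum_unit_exp)
      show "x \<in> F - {v} \<Longrightarrow> Poly_Mapping.lookup (t + (\<Sum>u\<in>?U. unit_exp u)) x \<le> 2"
        using goodD(3)[OF t, of x] F' fin by (auto simp: lookup_add lookup_sum_unit_exp)
      show "Poly_Mapping.lookup (t + (\<Sum>u\<in>?U. unit_exp u)) x \<le> 4" if "x \<in> W - {v}"
        using goodD(3,4)[OF t, of x] F'(1) fin that
        by (cases "x \<in> ?U") (auto simp: lookup_add lookup_sum_unit_exp)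
      show "Poly_Mapping.lookup (t + (\<Sum>u\<in>?U. unit_exp u)) v + card ?Q \<le> 2"
        using tv[OF goodD(1)[OF t]] irr fin card(1) card_mono[OF QF(2,1)]
        by (auto simp: lookup_add lookup_sum_unit_exp)
    qed auto
  next
    case False
    then have "card (nbhd E {v} \<inter> F - R) = 1"
      using card(2) QF(2) by (metis One_nat_def Suc_leI card_gt_0_iff finite_Diff le_antisym)
    then obtain w where w: "nbhd E {v} \<inter> F - R = {w}"
      by (rule card_1_singletonE)
    have wp: "w \<in> nbhd E {v}" "w \<in> F" "w \<notin> R" "w \<in> W" "w \<noteq> v"
      using w R irr by auto
    have A: "insert w ?U \<union> ?Q = ?N" "insert w ?U \<inter> R = {}"
      using w wp R by auto
    \<comment> \<open>One of the at most two neighbours in \<open>F\<close> is \<open>w\<close>, so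
      at most one root edge is charged to \<open>v\<close> and there is room for the edge to
      \<open>w\<close>.\<close>
    have cQ: "card ?Q \<le> 1"
    proof -
      have "card (insert w ?Q) \<le> card (nbhd E {v} \<inter> F)"
        using wp QF by (intro card_mono) auto
      then show ?thesis
        using card(1) wp fin(2) by simp
    qed
    show ?thesis
    \<comment> \<open>The bounds leave room for one more edge at \<open>w\<close> and at each vertex
      of \<open>?U\<close>. On \<open>?U\<close> the bound is 3 and not 2, since a competitor of
      \<open>t\<close> may exceed \<open>t\<close> by one there.\<close>
    proof (cases "\<exists>s. nz ?I s \<and> (\<forall>x\<in>R. Poly_Mapping.lookup s x = 0) \<and> Poly_Mapping.lookup s w \<le> 1 \<and>
        (\<forall>x\<in>F - {v}. Poly_Mapping.lookup s x \<le> 2) \<and> (\<forall>x\<in>?U. Poly_Mapping.lookup s x \<le> 3) \<and>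
        (\<forall>x\<in>W - {v}. Poly_Mapping.lookup s x \<le> 4)")
      case True
      then obtain s where s: "nz ?I s" "\<And>x. x \<in> R \<Longrightarrow> Poly_Mapping.lookup s x = 0"
        "Poly_Mapping.lookup s w \<le> 1" "\<And>x. x \<in> F - {v} \<Longrightarrow> Poly_Mapping.lookup s x \<le> 2"
        "\<And>x. x \<in> ?U \<Longrightarrow> Poly_Mapping.lookup s x \<le> 3" "\<And>x. x \<in> W - {v} \<Longrightarrow> Poly_Mapping.lookup s x \<le> 4"
        by blast
      let ?s = "s + (\<Sum>u\<in>insert w ?U. unit_exp u)"
      have val: "Poly_Mapping.lookup ?s x = Poly_Mapping.lookup s x + (if x \<in> insert w ?U then 1 else 0)" for x
        using fin(1) by (simp only: lookup_add lookup_sum_unit_exp finite_insert)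
      show ?thesis
      proof (rule finish[OF out[OF s(1)] A])
        show "insert w ?U \<subseteq> ?N"
          using wp by auto
        fix x
        show "x \<in> R \<Longrightarrow> Poly_Mapping.lookup ?s x = 0"
          using s(2)[of x] A(2) by (auto simp: val)
        show "x \<in> F - {v} \<Longrightarrow> Poly_Mapping.lookup ?s x \<le> 2"
          using s(3) s(4)[of x] by (auto simp: val)
        show "x \<in> W - {v} \<Longrightarrow> Poly_Mapping.lookup ?s x \<le> 4"
          using s(3) s(5,6)[of x] by (auto simp: val)
        show "Poly_Mapping.lookup ?s v + card ?Q \<le> 2"
          using tv[OF s(1)] wp irr cQ by (auto simp: val)
      qed
    next
      case False
      let ?s = "t + (\<Sum>u\<in>?U. unit_exp u) + unit_exp v"
      have val: "Poly_Mapping.lookup ?s x = Poly_Mapping.lookup t x + (if x \<in> ?U then 1 else 0) +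
          (if x = v then 1 else 0)" for x
        using fin(1) by (simp only: lookup_add lookup_sum_unit_exp lookup_unit_exp)
      have U2: "Poly_Mapping.lookup t x \<le> 2" if "x \<in> ?N" for x
        using goodD(3)[OF t, of x] F'(1) that by blast
      text \<open>Otherwise every monomial of the smaller graph meeting these bounds has exponent two at \<open>w\<close>,
        and charging the edge \<open>v w\<close> to \<open>v\<close> leaves a single contribution.\<close>
      have "nz (insert {v, w} (?I \<union> star v ?U)) ?s"
      proof (rule nz_star_swap[OF fin(1) goodD(1)[OF t] _ _ _ vI])
        show "star v ?U \<subseteq> E"
          by (rule star_subset) auto
        show "{v, w} \<in> E" "w \<notin> ?U"
          using wp by (auto simp: nbhd_def)
        \<comment> \<open>A competitor \<open>s\<close> is \<open>t\<close> with one unit moved from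
          \<open>w\<close> to \<open>u\<close>. As \<open>t\<close> is at most 2 at both,
          \<open>s\<close> would meet all the bounds just assumed unattainable.\<close>
        fix u s assume u: "u \<in> ?U" and eq: "t + unit_exp u = s + unit_exp w"
        have ev: "Poly_Mapping.lookup t x + (if x = u then 1 else 0) =
            Poly_Mapping.lookup s x + (if x = w then 1 else 0)" for x
          using arg_cong[OF eq, of "\<lambda>m. Poly_Mapping.lookup m x"] by (simp add: lookup_add lookup_unit_exp)
        have uw: "u \<noteq> w" "u \<notin> F" "u \<notin> R"
          using u wp R by auto
        have le: "Poly_Mapping.lookup s x \<le> Poly_Mapping.lookup t x" if "x \<noteq> u" for x
          using ev[of x] that by (auto split: if_splits)
        have su: "Poly_Mapping.lookup s u \<le> 3"
          using ev[of u] U2[of u] u uw by simp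
        have sw: "Poly_Mapping.lookup s w \<le> 1"
          using ev[of w] U2[of w] wp uw by simp
        have s0: "\<forall>x\<in>R. Poly_Mapping.lookup s x = 0"
          using le goodD(2)[OF t] uw by (metis le_zero_eq)
        have s2: "\<forall>x\<in>F - {v}. Poly_Mapping.lookup s x \<le> 2"
          using le goodD(3)[OF t] F'(2) uw by (metis le_trans subset_iff DiffD1)
        have s3: "\<forall>x\<in>?U. Poly_Mapping.lookup s x \<le> 3"
        proof
          fix x assume "x \<in> ?U"
          then show "Poly_Mapping.lookup s x \<le> 3"
            using le[of x] U2[of x] su by (cases "x = u") auto
        qed
        have s4: "\<forall>x\<in>W - {v}. Poly_Mapping.lookup s x \<le> 4"
        proof
          fix x assume "x \<in> W - {v}"
          then show "Poly_Mapping.lookup s x \<le> 4"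
            using le[of x] goodD(4)[OF t, of x] su by (cases "x = u") auto
        qed
        show "\<not> nz ?I s"
          using False s0 sw s2 s3 s4 by blast
      qed
      moreover have "insert {v, w} (?I \<union> star v ?U) = ?I \<union> star v (insert w ?U)"
        by (auto simp: star_def)
      ultimately have nzs: "nz (?I \<union> star v (insert w ?U)) ?s"
        by simp
      show ?thesis
      proof (rule finish[OF nzs A])
        fix x
        show "x \<in> R \<Longrightarrow> Poly_Mapping.lookup ?s x = 0"
          using goodD(2)[OF t, of x] R v(2) by (auto simp: val)
        show "x \<in> F - {v} \<Longrightarrow> Poly_Mapping.lookup ?s x \<le> 2"
          using goodD(3)[OF t, of x] F'(2) by (auto simp: val)
        show "x \<in> W - {v} \<Longrightarrow> Poly_Mapping.lookup ?s x \<le> 4"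
          using goodD(4)[OF t, of x] U2[of x] by (auto simp: val)
        show "Poly_Mapping.lookup ?s v + card ?Q \<le> 2"
          using tv[OF goodD(1)[OF t]] irr cQ by (auto simp: val)
      qed
    qed
  qed
qed

end

section \<open>The induction\<close>

locale plane_forms = plane_graph V E p g + edge_forms E f
  for V :: "'v set" and E and p g and f
begin

text \<open>For the same \<open>W\<close>, fewer roots are reduced to more: a root with a neighbour
  in \<open>F\<close> is completed to a root edge, and an empty root set borrows a root from
  \<open>F\<close> if there is one. Only two roots require the planarity argument.\<close>

lemma good_exists:
  assumes "W \<subseteq> V" "gconnected E Z" "Z \<inter> W = {}" "R \<subseteq> nbhd E Z \<inter> W" "card R \<le> 2" "card R = 2 \<Longrightarrow> R \<in> E"
  shows "\<exists>t. good W (nbhd E Z \<inter> W) R t"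
  using assms
proof (induction "card W" arbitrary: W Z R rule: less_induct)
  case less
  define F where "F = nbhd E Z \<inter> W"
  have FW: "F \<subseteq> W"
    by (simp add: F_def)
  have finW: "finite W"
    using finite_subset[OF less.prems(1) finite_V] .
  have IH: "\<exists>t. good W' (nbhd E Z' \<inter> W') R' t"
    if "W' \<subset> W" "gconnected E Z'" "Z' \<inter> W' = {}" "R' \<subseteq> nbhd E Z' \<inter> W'" "card R' \<le> 2" "card R' = 2 \<Longrightarrow> R' \<in> E"
    for W' Z' R'
    using less.hyps[of W' Z' R'] psubset_card_mono[OF finW that(1)] that less.prems(1) by blast
  have Zv: "gconnected E (insert v Z)" if v: "v \<in> F" for v
  proof -
    obtain z where "z \<in> Z" "{z, v} \<in> E"
      using v by (auto simp: F_def nbhd_def)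
    then show ?thesis
      using gconnected_insert[OF less.prems(2)] by blast
  qed
  have Zd: "Z \<inter> W = {}"
    by (rule less.prems(3))
  have nb: "nbhd E (insert v A) = nbhd E {v} \<union> nbhd E A" for v A
    by (auto simp: nbhd_def)
  have two: "\<exists>t. good W F {a, b} t" if ab: "{a, b} \<in> E" "{a, b} \<subseteq> F" for a b
  proof (cases "F = {a, b}")
    case True
    have "a \<noteq> b"
      using no_loop ab(1) by auto
    obtain t where t: "good (W - {a, b}) (nbhd E (insert b (insert a Z)) \<inter> (W - {a, b})) {} t"
    proof -
      have "gconnected E (insert b (insert a Z))"
        by (rule gconnected_insert[OF Zv _ ab(1)]) (use ab in auto)
      moreover have "W - {a, b} \<subset> W" "insert b (insert a Z) \<inter> (W - {a, b}) = {}"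
        using ab(2) FW Zd by blast+
      ultimately show ?thesis
        using IH[of "W - {a, b}" "insert b (insert a Z)" "{}"] that by auto
    qed
    have abW: "a \<in> W" "b \<in> W"
      using ab(2) FW by auto
    have N: "nbhd E {a} \<inter> W - {b} \<subseteq> nbhd E (insert b (insert a Z)) \<inter> (W - {a, b})"
      "nbhd E {b} \<inter> W - {a} \<subseteq> nbhd E (insert b (insert a Z)) \<inter> (W - {a, b})"
      using nbhd_irrefl[of a] nbhd_irrefl[of b] nb[of b "insert a Z"] nb[of a Z] by blast+
    obtain t' where "good W {a, b} {a, b} t'"
      by (rule good_remove_both_roots[OF t ab(1) abW N])
    then show ?thesis
      using True by auto
  next
    case False
    show ?thesis
    proof (cases "\<exists>v\<in>F - {a, b}. card (nbhd E {v} \<inter> F) \<le> 2 \<and> card (nbhd E {v} \<inter> F - {a, b}) \<le> 1")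
      case True
      then obtain v where v: "v \<in> F" "v \<notin> {a, b}" "card (nbhd E {v} \<inter> F) \<le> 2"
        "card (nbhd E {v} \<inter> F - {a, b}) \<le> 1"
        by blast
      let ?F' = "nbhd E (insert v Z) \<inter> (W - {v})"
      have F': "nbhd E {v} \<inter> W \<subseteq> ?F'" "F - {v} \<subseteq> ?F'"
        unfolding nb[of v Z] F_def using nbhd_irrefl[of v] by blast+
      have "\<exists>t. good (W - {v}) ?F' {a, b} t"
      proof (rule IH[OF _ Zv[OF v(1)]])
        show "W - {v} \<subset> W"
          using v(1) FW by blast
        show "insert v Z \<inter> (W - {v}) = {}"
          using Zd by blast
        show "{a, b} \<subseteq> ?F'"
          using ab(2) v(2) F'(2) by blast
        show "card {a, b} \<le> 2"
          by (simp add: card_insert_if)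
      qed (rule ab(1))
      then obtain t where "good (W - {v}) ?F' {a, b} t" ..
      then show ?thesis
        by (rule good_remove[OF v(1,2) ab(2) FW _ F' v(3,4)])
    next
      case none: False
      obtain D S where DS: "{a, b} \<subseteq> D" "D \<subseteq> W" "S \<subseteq> F" "S \<inter> D = {}" "D \<union> S \<noteq> W" "card S \<le> 2"
        "card S = 2 \<Longrightarrow> S \<in> E" "nbhd E D \<inter> W \<subseteq> D \<union> S"
        by (rule removable_or_separation[OF less.prems(1-3) F_def refl ab(1,2) False]) (use none in blast)+
      let ?W1 = "D \<union> S" and ?W2 = "W - D"
      have WW: "?W1 \<union> ?W2 = W" "?W1 \<inter> ?W2 = S"
        using DS FW by blast+
      obtain t1 where t1: "good ?W1 (nbhd E Z \<inter> ?W1) {a, b} t1"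
      proof -
        have "?W1 \<subset> W" "Z \<inter> ?W1 = {}"
          using DS(2,3,5) FW Zd by blast+
        moreover have "{a, b} \<subseteq> nbhd E Z \<inter> ?W1"
          using DS(1) ab(2) F_def by blast
        moreover have "card {a, b} \<le> 2"
          by (simp add: card_insert_if)
        ultimately show ?thesis
          using IH[of ?W1 Z "{a, b}"] ab(1) less.prems(2) that by blast
      qed
      \<comment> \<open>The second piece gets the separator as its roots and keeps the same deleted
        set \<open>Z\<close>.\<close>
      obtain t2 where t2: "good ?W2 (nbhd E Z \<inter> ?W2) S t2"
      proof -
        have "?W2 \<subset> W"
          using DS(1,2) by blast
        moreover have "S \<subseteq> nbhd E Z \<inter> ?W2"
          using DS(3,4) F_def by blast
        ultimately show ?thesis
          using IH[of ?W2 Z S] DS(6,7) Zd less.prems(2) that by blast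
      qed
      have sep: "induced (?W1 \<union> ?W2) = induced ?W1 \<union> induced ?W2"
      proof (intro equalityI subsetI)
        fix e assume e: "e \<in> induced (?W1 \<union> ?W2)"
        then have eE: "e \<in> E" "e \<subseteq> W"
          using WW(1) by (auto simp: induced_def)
        show "e \<in> induced ?W1 \<union> induced ?W2"
        proof (cases "e \<inter> D = {}")
          case True
          then show ?thesis using eE by (auto simp: induced_def)
        next
          case False
          then obtain x where x: "x \<in> e" "x \<in> D" by blast
          then obtain y where y: "e = {x, y}"
            using edges[OF eE(1)] by (auto simp: card_2_iff)
          then have "y \<in> nbhd E D \<inter> W"
            using eE x by (auto simp: nbhd_def)
          then show ?thesis
            using eE x y DS(8) by (auto simp: induced_def)
        qed
      qed (auto simp: induced_def)
      have "good (?W1 \<union> ?W2) F {a, b} (t1 + t2)"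
      proof (rule good_glue[OF t1 _ sep])
        show "good ?W2 (nbhd E Z \<inter> ?W2) (?W1 \<inter> ?W2) t2"
          unfolding WW(2) by (rule t2)
        show "card (?W1 \<inter> ?W2) \<le> 2"
          unfolding WW(2) by (rule DS(6))
        show "finite ?W1"
          using WW(1) finW by (metis finite_Un)
      qed (use DS FW in \<open>auto simp: F_def\<close>)
      then show ?thesis
        unfolding WW(1) by blast
    qed
  qed
  have one: "\<exists>t. good W F {a} t" if a: "a \<in> F" for a
  proof (cases "nbhd E {a} \<inter> F = {}")
    \<comment> \<open>Charging all edges at \<open>a\<close> outwards then increases no exponent on
      \<open>F\<close>.\<close>
    case True
    have "\<exists>t. good (W - {a}) (nbhd E (insert a Z) \<inter> (W - {a})) {} t"
      using a FW Zd by (intro IH[OF _ Zv[OF a]]) auto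
    then obtain t where t: "good (W - {a}) (nbhd E (insert a Z) \<inter> (W - {a})) {} t" ..
    have aW: "a \<in> W"
      using a FW by blast
    have "nbhd E {a} \<inter> W \<subseteq> nbhd E (insert a Z) \<inter> (W - {a})" "F - {a} \<subseteq> nbhd E (insert a Z) \<inter> (W - {a})"
      unfolding nb[of a Z] F_def using nbhd_irrefl[of a] by blast+
    then have "good W F {a} (t + (\<Sum>u\<in>nbhd E {a} \<inter> W. unit_exp u))"
      using aW t True by (intro good_remove_to_nbhd)
    then show ?thesis ..
  next
    case False
    then obtain b where b: "{a, b} \<in> E" "b \<in> F"
      by (auto simp: nbhd_def)
    then obtain t where "good W F {a, b} t"
      using two[OF b(1)] a by blast
    then have "good W F {a} (t + unit_exp b)"
      using b a FW by (intro good_unroot) auto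
    then show ?thesis ..
  qed
  have zero: "\<exists>t. good W F {} t"
  proof (cases "F = {}")
    case False
    then obtain a where "a \<in> F"
      by blast
    then show ?thesis
      using one good_forget_root by blast
  next
    case True
    show ?thesis
    proof (cases "W = {}")
      case True
      have ind: "induced W - {{}} = {}"
        using True by (auto simp: induced_def)
      have "good W F {} 0"
        by (rule goodI, unfold ind) (simp_all add: nz_empty)
      then show ?thesis ..
    next
      case False
      then obtain a where a: "a \<in> W"
        by blast
      \<comment> \<open>No vertex of \<open>W\<close> is adjacent to \<open>Z\<close>, so
        \<open>Z\<close> is abandoned and deletion restarts at \<open>a\<close>. This is how the
        start of the induction and further components are handled.\<close>
      have "\<exists>t. good (W - {a}) (nbhd E {a} \<inter> (W - {a})) {} t"
        using a by (intro IH gconnected_singleton) auto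
      then obtain t where t: "good (W - {a}) (nbhd E {a} \<inter> (W - {a})) {} t" ..
      have "good W F {a} (t + (\<Sum>u\<in>nbhd E {a} \<inter> W. unit_exp u))"
        using nbhd_irrefl[of a] True by (intro good_remove_to_nbhd[OF a t]) auto
      then show ?thesis
        using good_forget_root by blast
    qed
  qed
  have RF: "R \<subseteq> F"
    using less.prems(4) F_def by simp
  have finR: "finite R"
    using finite_subset[OF RF] finite_subset[OF FW finW] by blast
  have "\<exists>t. good W F R t"
  proof (cases "R = {}")
    case True
    then show ?thesis using zero by simp
  next
    case False
    then have "card R = 1 \<or> card R = 2"
      using less.prems(5) finR card_0_eq[of R] by linarith
    then show ?thesis
    proof
      assume "card R = 1"
      then obtain a where "R = {a}"
        by (rule card_1_singletonE)
      then show ?thesis using one RF by auto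
    next
      assume c: "card R = 2"
      then obtain a b where "R = {a, b}"
        by (auto simp: card_2_iff)
      then show ?thesis
        using two RF less.prems(6)[OF c] by auto
    qed
  qed
  then show ?case
    by (simp add: F_def)
qed

end

text \<open>For an edge and a linear order just one ordered pair qualifies. Writing a product over
  it avoids choosing an orientation and lets the graph polynomial be regrouped by edges.\<close>

definition edge_factor :: "'v rel \<Rightarrow> ('v set \<Rightarrow> int) \<Rightarrow> 'v set \<Rightarrow> 'v int_mpoly" where
  "edge_factor r \<sigma> e = (\<Prod>(u, v) | {u, v} = e \<and> (u, v) \<in> r \<and> u \<noteq> v. Var u - of_int (\<sigma> {u, v}) * Var v)"

lemma of_int_mult_Var:
  fixes v :: 'v
  shows "of_int c * Var v = Poly_Mapping.single (unit_exp v) c"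
proof -
  have "of_int c = (Poly_Mapping.single 0 c :: 'v int_mpoly)"
    by (metis id_apply of_int_eq_id single_of_int)
  then show ?thesis
    by (simp add: Var_def unit_exp_def mult_single)
qed

lemma edge_factor_eq:
  assumes "linear_order_on V r" "u \<in> V" "v \<in> V" "u \<noteq> v" "\<sigma> {u, v} \<noteq> 0"
  shows "\<exists>a b. a \<noteq> 0 \<and> b \<noteq> 0 \<and>
    edge_factor r \<sigma> {u, v} = Poly_Mapping.single (unit_exp u) a + Poly_Mapping.single (unit_exp v) b"
proof -
  have *: "edge_factor r \<sigma> {x, y} = Poly_Mapping.single (unit_exp x) 1 + Poly_Mapping.single (unit_exp y) (- \<sigma> {x, y})"
    if "(x, y) \<in> r" "x \<noteq> y" for x y
  proof -
    have "(y, x) \<notin> r"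
      using assms(1) that by (auto simp: linear_order_on_def partial_order_on_def antisym_def)
    then have "{(a, b). {a, b} = {x, y} \<and> (a, b) \<in> r \<and> a \<noteq> b} = {(x, y)}"
      using that by (auto simp: doubleton_eq_iff)
    then show ?thesis
      by (simp add: edge_factor_def of_int_mult_Var single_uminus)
        (simp add: Var_def unit_exp_def)
  qed
  have "(u, v) \<in> r \<or> (v, u) \<in> r"
    using assms(1-4) by (auto simp: linear_order_on_def total_on_def)
  then show ?thesis
  proof
    assume "(u, v) \<in> r"
    then show ?thesis
      using *[of u v] assms(4,5) by (intro exI[of _ 1] exI[of _ "- \<sigma> {u, v}"]) simp
  next
    assume "(v, u) \<in> r"
    then show ?thesis
      using *[of v u] assms(4,5)
      by (intro exI[of _ "- \<sigma> {u, v}"] exI[of _ 1]) (simp add: insert_commute add.commute)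
  qed
qed

lemma graph_polynomial_eq_prod:
  assumes "finite V" "\<And>e. e \<in> E \<Longrightarrow> e \<subseteq> V"
  shows "graph_polynomial r E \<sigma> = prod (edge_factor r \<sigma>) E"
proof -
  let ?P = "{(u, v). {u, v} \<in> E \<and> (u, v) \<in> r \<and> u \<noteq> v}"
  let ?h = "\<lambda>(u, v). Var u - of_int (\<sigma> {u, v}) * Var v"
  let ?e = "\<lambda>(u, v). {u, v}"
  have "?P \<subseteq> V \<times> V"
    using assms(2) by blast
  then have "finite ?P"
    using finite_subset assms(1) by blast
  moreover have "finite E"
    using assms by (intro finite_subset[of E "Pow V"]) auto
  ultimately have "(\<Prod>e\<in>E. prod ?h {x \<in> ?P. ?e x = e}) = prod ?h ?P"
    by (intro prod.group) auto
  moreover have "prod ?h {x \<in> ?P. ?e x = e} = edge_factor r \<sigma> e" if "e \<in> E" for e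
    unfolding edge_factor_def using that by (intro prod.cong) auto
  ultimately show ?thesis
    unfolding graph_polynomial_def by (metis (no_types, lifting) prod.cong)
qed

theorem theorem1p4:
  fixes V :: "'v set" and E :: "'v set set" and \<sigma> :: "'v set \<Rightarrow> int" and r :: "'v rel"
  assumes "signed_graph V E \<sigma>"
    and "linear_order_on V r"
    and "planar V E"
  shows "Alon_Tarsi_number r V E \<sigma> \<le> 5"
proof -
  interpret signed_graph V E \<sigma>
    by (rule assms(1))
  obtain p g where "plane_drawing V E p g"
    using assms(3) by (auto simp: planar_def)
  then interpret plane_graph V E p g
    by unfold_locales
  have form: "\<exists>a b. a \<noteq> 0 \<and> b \<noteq> 0 \<and>
      edge_factor r \<sigma> {u, v} = Poly_Mapping.single (unit_exp u) a + Poly_Mapping.single (unit_exp v) b"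
    if "{u, v} \<in> E" "u \<noteq> v" for u v
    using edge_factor_eq[OF assms(2), of u v \<sigma>] edges[OF that(1)] signs[OF that(1)] that(2) by auto
  interpret plane_forms V E p g "edge_factor r \<sigma>"
    using edges finite_E form by unfold_locales auto
  \<comment> \<open>With nothing deleted there are no outer vertices and no roots, so only the bound
    4 remains.\<close>
  obtain t where t: "good V {} {} t"
    using good_exists[of V "{}" "{}"] by (auto simp: gconnected_def nbhd_def)
  \<comment> \<open>The empty set is no edge, so the empty root set omits nothing.\<close>
  have "induced V - {{}} = E"
    using edges edges[of "{}"] by (auto simp: induced_def)
  then have "Poly_Mapping.lookup (graph_polynomial r E \<sigma>) t \<noteq> 0"
    using goodD(1)[OF t] graph_polynomial_eq_prod[OF finite_V, of E r \<sigma>] edges by (simp add: nz_def)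
  moreover have "\<forall>v\<in>V. Poly_Mapping.lookup t v < 5"
    using goodD(4)[OF t] by fastforce
  ultimately show ?thesis
    unfolding Alon_Tarsi_number_def by (intro Least_le) blast
qed

end
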